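(* Let $\mathcal{P}:=(P^i)_{i=1}^n$ be the SOS2 constraint on $\Delta^{n+1}$. Then \begin{itemize} \item $\operatorname{mc}_G(\mathcal{P})=2\lceil\log_2 n\rceil$, and \item $n+3+\lceil\log_2 n\rceil\leq\operatorname{mc}(\mathcal{P})\leq n+3+2\lceil\log_2 n\rceil$. \end{itemize}
   Context: $\Delta^{n+1}:=\{\lambda\in\mathbb{R}^{n+1}_+ : \sum_{j=1}^{n+1}\lambda_j=1\}$. The SOS2 constraint on $\Delta^{n+1}$ is the family $(P^i)_{i=1}^n$ with $P^i:=\{\lambda\in\Delta^{n+1} : \lambda_j\leq 0\ \forall j\notin\{i,i+1\}\}=\operatorname{conv}(\{\mathbf{e}^i,\mathbf{e}^{i+1}\})$, where $\mathbf{e}^i$ is the $i$-th unit vector. $\mathcal{H}_k(n)$ is the set of families $H=(h^i)_{i=1}^n$ of pairwise distinct vectors $h^i\in\{0,1\}^k$. $Q(\mathcal{P},H):=\operatorname{conv}\left(\bigcup_{i=1}^n P^i\times\{h^i\}\right)$. For a polyhedron $Q$, $\operatorname{size}(Q)$ is the minimum number of linear inequalities needed to describe $Q$, with each equation counted as two inequalities. The embedding complexity of $\mathcal{P}$ is $\operatorname{mc}(\mathcal{P}):=\min\{\operatorname{size}(Q(\mathcal{P},H)) : H\in\bigcup_{k\geq\lceil\log_2 n\rceil}\mathcal{H}_k(n)\}$. For $H\in\mathcal{H}_k(n)$ let $L(H):=\operatorname{aff}(H)-h^1$, $\dim(H):=\dim(\operatorname{aff}(H))$ and $c^i:=h^{i+1}-h^i$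 for $i\in\{1,\dots,n-1\}$. For $b\in L(H)\setminus\{\mathbf{0}\}$ let $M(b):=\{y\in L(H) : b\cdot y=0\}$. Let $b^1,\dots,b^L\in L(H)\setminus\{\mathbf 0\}$ be such that $M(b^1),\dots,M(b^L)$ lists, without repetition, the linear hyperplanes of $L(H)$ that are spanned by subsets of $\{c^i\}_{i=1}^{n-1}$ (with the span of the empty set being $\{\mathbf 0\}$), and let $J=\{1,n+1\}\cup\{j\in\{2,\dots,n\} : L(H)=\operatorname{span}(\{c^i\}_{i\in\{1,\dots,n-1\}\setminus\{j-1\}})\}$. With $h^0:=h^1$ and $h^{n+1}:=h^n$, the polyhedron $Q(\mathcal{P},H)$ is described by the equations $\sum_{j=1}^{n+1}\lambda_j=1$, $y\in\operatorname{aff}(H)$, together with the general inequalities $$\sum_{j=1}^{n+1}\min\{b^l\cdot h^j,b^l\cdot h^{j-1}\}\lambda_j\leq b^l\cdot y\leq\sum_{j=1}^{n+1}\max\{b^l\cdot h^j,b^l\cdot h^{j-1}\}\lambda_j,\quad l\in\{1,\dots,L\},$$ and the bounds $\lambda_j\geq0$, $j\in J$, all of these inequalities being facet defining. $\operatorname{size}_G(Q(\mathcal{P},H))$ is the number of general inequalities (i.e. $2L$), $\operatorname{size}_B(Q(\mathcal{P},H))$ is the number of bounds (i.e. $|J|$), and $\operatorname{size}(Q(\mathcal{P},H))=\operatorname{size}_G(Q(\mathcal{P},H))+\operatorname{size}_B(Q(\mathcal{P},H))+2(1+k-\dim(H))$. Finally, $\operatorname{mc}_G(\mathcal{P}):=\min\{\operatorname{size}_G(Q(\mathcal{P},H))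 : H\in\bigcup_{k\geq\lceil\log_2 n\rceil}\mathcal{H}_k(n)\}$. *)

theory Defs
  imports "HOL-Analysis.Analysis" "HOL-Analysis.Finite_Function_Topology"
begin

(* The dimension of the 0/1 codes varies inside one formula, so R^d cannot be a type here. It is
   the subspace of finitely supported functions with support in {1..d}; on this type the library
   provides the real_vector structure, hence span, affine hull and convex hull. *)

type_synonym fvec = "(nat, real) poly_mapping"

abbreviation coord :: "fvec \<Rightarrow> nat \<Rightarrow> real"
  where "coord \<equiv> Poly_Mapping.lookup"

definition Rn :: "nat \<Rightarrow> fvec set"
  where "Rn d = {x. Poly_Mapping.keys x \<subseteq> {1..d}}"

definition dot :: "nat \<Rightarrow> fvec \<Rightarrow> fvec \<Rightarrow> real"
  where "dot d a x = (\<Sum>j=1..d. coord a j * coord x j)"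

definition dot_pair :: "nat \<Rightarrow> nat \<Rightarrow> fvec \<times> fvec \<Rightarrow> fvec \<times> fvec \<Rightarrow> real"
  where "dot_pair m k a x = dot m (fst a) (fst x) + dot k (snd a) (snd x)"

definition unit_simplex :: "nat \<Rightarrow> fvec set"
  where "unit_simplex m =
    {x \<in> Rn m. (\<forall>j\<in>{1..m}. 0 \<le> coord x j) \<and> (\<Sum>j=1..m. coord x j) = 1}"

definition sos2 :: "nat \<Rightarrow> nat \<Rightarrow> fvec set"
  where "sos2 n i =
    {x \<in> unit_simplex (n + 1). \<forall>j\<in>{1..n + 1} - {i, i + 1}. coord x j \<le> 0}"

(* Families (H 1, ..., H n) are functions on nat; values outside {1..n} are never used below. *)

definition encodings :: "nat \<Rightarrow> nat \<Rightarrow> (nat \<Rightarrow> fvec) set"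
  where "encodings k n =
    {H. (\<forall>i\<in>{1..n}. H i \<in> Rn k \<and> (\<forall>j\<in>{1..k}. coord (H i) j \<in> {0, 1})) \<and> inj_on H {1..n}}"

definition embedding :: "nat \<Rightarrow> (nat \<Rightarrow> fvec set) \<Rightarrow> (nat \<Rightarrow> fvec) \<Rightarrow> (fvec \<times> fvec) set"
  where "embedding n P H = convex hull (\<Union>i\<in>{1..n}. P i \<times> {H i})"

(* E holds the equations a . x = c and I the inequalities a . x <= c of a description of Q in
   R^m x R^k. The last conjunct says that every affine equation valid on Q has to come from E.
   Without it, counting equations twice would be void: an affine subspace of codimension r is the
   solution set of only r + 1 inequalities. With it, the minimum below is the number of facets plus
   twice the codimension of Q. *)

definition describes ::
    "nat \<Rightarrow> nat \<Rightarrow> ((fvec \<times> fvec) \<times> real) set \<Rightarrow> ((fvec \<times> fvec) \<times> real) set \<Rightarrow> (fvec \<times> fvec) set \<Rightarrow> bool"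
  where "describes m k E I Q \<longleftrightarrow>
    finite E \<and> finite I \<and> E \<union> I \<subseteq> (Rn m \<times> Rn k) \<times> UNIV \<and>
    Q = {x \<in> Rn m \<times> Rn k. (\<forall>(a, c)\<in>E. dot_pair m k a x = c) \<and> (\<forall>(a, c)\<in>I. dot_pair m k a x \<le> c)} \<and>
    (\<forall>(a, c)\<in>I. \<exists>x\<in>Q. dot_pair m k a x < c)"

definition poly_size :: "nat \<Rightarrow> nat \<Rightarrow> (fvec \<times> fvec) set \<Rightarrow> nat"
  where "poly_size m k Q = Inf {2 * card E + card I | E I. describes m k E I Q}"

definition mc :: "nat \<Rightarrow> nat \<Rightarrow> (nat \<Rightarrow> fvec set) \<Rightarrow> nat"
  where "mc m n P =
    Inf {poly_size m k (embedding n P H) | k H. \<lceil>log 2 (real n)\<rceil> \<le> int k \<and> H \<in> encodings k n}"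

definition lin_space :: "nat \<Rightarrow> (nat \<Rightarrow> fvec) \<Rightarrow> fvec set"
  where "lin_space n H = (\<lambda>y. y - H 1) ` (affine hull (H ` {1..n}))"

definition diffs :: "nat \<Rightarrow> (nat \<Rightarrow> fvec) \<Rightarrow> fvec set"
  where "diffs n H = (\<lambda>i. H (i + 1) - H i) ` {1..<n}"

definition hyperplane :: "nat \<Rightarrow> nat \<Rightarrow> (nat \<Rightarrow> fvec) \<Rightarrow> fvec \<Rightarrow> fvec set"
  where "hyperplane n k H b = {y \<in> lin_space n H. dot k b y = 0}"

definition spanned_hyperplanes :: "nat \<Rightarrow> nat \<Rightarrow> (nat \<Rightarrow> fvec) \<Rightarrow> fvec set set"
  where "spanned_hyperplanes n k H =
    {hyperplane n k H b | b. b \<in> lin_space n H - {0} \<and> (\<exists>S\<subseteq>diffs n H. hyperplane n k H b = span S)}"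

(* For P = sos2 n, each spanned hyperplane, with normal b in lin_space n H, gives the two general
   inequalities
     (SUM j=1..n+1. min (b . H j) (b . H (j - 1)) * x j) <= b . y
       <= (SUM j=1..n+1. max (b . H j) (b . H (j - 1)) * x j)
   of embedding n P H, where H 0 is read as H 1 and H (n + 1) as H n. They, the bounds 0 <= x j for
   j in {1, n + 1} and for those j in {2..n} such that the differences other than H j - H (j - 1)
   still span lin_space n H, and the equations for the affine hull describe embedding n P H. *)

definition size_G_sos2 :: "nat \<Rightarrow> nat \<Rightarrow> (nat \<Rightarrow> fvec) \<Rightarrow> nat"
  where "size_G_sos2 n k H = 2 * card (spanned_hyperplanes n k H)"

definition mc_G_sos2 :: "nat \<Rightarrow> nat"
  where "mc_G_sos2 n =
    Inf {size_G_sos2 n k H | k H. \<lceil>log 2 (real n)\<rceil> \<le> int k \<and> H \<in> encodings k n}"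

end

theory Submission
  imports Defs
begin

text \<open>
  Let d be the dimension of the affine hull of the codes.

  The number of general inequalities is twice the number of hyperplanes spanned by the differences
  of consecutive codes. A basis of d differences already spans d hyperplanes
  (card_basis_le_spanned_hyperplanes), and a flat of dimension d contains at most 2 ^ d points with
  coordinates 0 and 1 (card_zero_one_points_le), so there are at least \<lceil>log 2 n\<rceil> of them. A Gray code
  of length \<lceil>log 2 n\<rceil> has only multiples of unit vectors as differences and therefore spans only the
  coordinate hyperplanes (card_spanned_hyperplanes_gray).

  The lower bound on the size is no facet count. A nonempty bounded polyhedron in a space of
  dimension N that is not a single point needs more than N constraints, because otherwise it
  contains a ray (describes_needs_constraints); here N = (n + 1) + k. One of the constraints must be
  an equation, since the multipliers, the coordinates of the simplex, add up to 1
  (describes_needs_equation), and it counts twice. This gives n + 3 + k for every code of length k. The bound concerns an infimum over descriptions,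
  so a description has to exist for every code; it comes from the inequalities of the cone
  generated by the vertices (nonneg_combs_polyhedral).

  For the upper bound, a Gray code is described by the equation for the sum of the multipliers,
  n + 1 bounds and two general inequalities for each of the \<lceil>log 2 n\<rceil> coordinates
  (gray_description). These suffice because the two vertices over each unit vector differ in at
  most one coordinate, so that the positions in different coordinates can be chosen independently
  (gray_description_inner).
\<close>

section \<open>Coordinates and linear functionals\<close>

lemma coord_scaleR [simp]: "coord (r *\<^sub>R x) i = r * coord x i"
  by (simp add: scaleR_poly_mapping_def)

lemma in_Rn_iff: "x \<in> Rn d \<longleftrightarrow> (\<forall>j. j \<notin> {1..d} \<longrightarrow> coord x j = 0)"
  unfolding Rn_def by (auto simp: in_keys_iff subset_iff)

lemma subspace_Rn: "subspace (Rn d)"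
  by (auto simp: subspace_def in_Rn_iff lookup_add)

lemma Rn_eqI:
  assumes "x \<in> Rn d" "y \<in> Rn d" "\<And>j. j \<in> {1..d} \<Longrightarrow> coord x j = coord y j"
  shows "x = y"
  using assms by (intro poly_mapping_eqI) (metis in_Rn_iff)

lemma linear_dot: "linear (dot d a)"
  by (rule linearI)
    (simp_all add: dot_def lookup_add algebra_simps sum.distrib sum_distrib_left)

lemma dot_commute: "dot d a x = dot d x a"
  by (simp add: dot_def mult.commute)

lemma dot_self_eq_0:
  assumes "x \<in> Rn d" "dot d x x = 0"
  shows "x = 0"
proof (rule Rn_eqI[OF assms(1)])
  show "0 \<in> Rn d" by (simp add: subspace_0 subspace_Rn)
  fix j assume "j \<in> {1..d}"
  moreover have "\<forall>j\<in>{1..d}. coord x j * coord x j = 0"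
    using assms(2) unfolding dot_def by (subst (asm) sum_nonneg_eq_0_iff) auto
  ultimately show "coord x j = coord 0 j" by simp
qed

lemma linear_dot_pair: "linear (dot_pair m k a)"
  using linear_dot[of m "fst a"] linear_dot[of k "snd a"]
  by (intro linearI) (simp_all add: dot_pair_def linear_add linear_scale algebra_simps)

lemma dot_pair_commute: "dot_pair m k a x = dot_pair m k x a"
  by (simp add: dot_pair_def dot_commute)

lemmas dot_pair_simps =
  linear_add[OF linear_dot_pair] linear_scale[OF linear_dot_pair] linear_diff[OF linear_dot_pair]
  linear_0[OF linear_dot_pair] linear_neg[OF linear_dot_pair] linear_sum[OF linear_dot_pair]

lemma dot_pair_simps_left:
  "dot_pair m k (a + b) x = dot_pair m k a x + dot_pair m k b x"
  "dot_pair m k (a - b) x = dot_pair m k a x - dot_pair m k b x"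
  "dot_pair m k (r *\<^sub>R a) x = r * dot_pair m k a x"
  "dot_pair m k (- a) x = - dot_pair m k a x"
  by (simp_all add: dot_pair_commute[of m k _ x] dot_pair_simps)

lemma subspace_Rn_Times: "subspace (Rn m \<times> Rn k)"
  by (rule subspace_Times) (rule subspace_Rn)+

definition unit_vec :: "nat \<Rightarrow> fvec"
  where "unit_vec j = Poly_Mapping.single j 1"

lemma coord_unit_vec [simp]: "coord (unit_vec j) i = (if i = j then 1 else 0)"
  by (simp add: unit_vec_def lookup_single when_def)

lemma unit_vec_in_Rn [simp]: "unit_vec j \<in> Rn d \<longleftrightarrow> j \<in> {1..d}"
  by (auto simp: in_Rn_iff)

lemma dot_unit_vec [simp]: "j \<in> {1..d} \<Longrightarrow> dot d (unit_vec j) x = coord x j"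
  unfolding dot_def by (simp add: if_distrib[of "\<lambda>c. c * _"] sum.delta cong: if_cong)

lemma dot_unit_vec_right: "j \<in> {1..d} \<Longrightarrow> dot d x (unit_vec j) = coord x j"
  by (subst dot_commute) (rule dot_unit_vec)

definition fvec_of :: "nat \<Rightarrow> (nat \<Rightarrow> real) \<Rightarrow> fvec"
  where "fvec_of d f = (\<Sum>j=1..d. f j *\<^sub>R unit_vec j)"

lemma coord_fvec_of: "coord (fvec_of d f) i = (if i \<in> {1..d} then f i else 0)"
  unfolding fvec_of_def
  by (simp add: lookup_sum if_distrib[of "\<lambda>c. _ * c"] sum.delta cong: if_cong)

lemma fvec_of_in_Rn [simp]: "fvec_of d f \<in> Rn d"
  by (simp add: in_Rn_iff coord_fvec_of)

lemma dot_fvec_of [simp]: "dot d (fvec_of d f) x = (\<Sum>j=1..d. f j * coord x j)"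
  unfolding dot_def by (rule sum.cong) (auto simp: coord_fvec_of)

lemma fvec_of_coord: "x \<in> Rn d \<Longrightarrow> fvec_of d (coord x) = x"
  by (rule Rn_eqI[of _ d]) (auto simp: coord_fvec_of)

lemma dot_0_left [simp]: "dot d 0 x = 0"
  by (simp add: dot_def)

lemma independent_if_dual:
  fixes b :: "'i \<Rightarrow> 'a::real_vector"
  assumes lin: "\<And>i. i \<in> I \<Longrightarrow> linear (g i)"
    and one: "\<And>i. i \<in> I \<Longrightarrow> g i (b i) = (1::real)"
    and zero: "\<And>i j. i \<in> I \<Longrightarrow> j \<in> I \<Longrightarrow> i \<noteq> j \<Longrightarrow> g i (b j) = 0"
  shows "independent (b ` I) \<and> inj_on b I"
proof
  show "inj_on b I" by (rule inj_onI) (metis one zero zero_neq_one)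
  show "independent (b ` I)" unfolding dependent_def
  proof clarify
    fix i assume i: "i \<in> I" "b i \<in> span (b ` I - {b i})"
    have "g i (b i) = 0"
      by (rule linear_eq_0_on_span[OF lin[OF i(1)] _ i(2)]) (use i(1) zero in auto)
    then show False using one[OF i(1)] by simp
  qed
qed

lemma Rn_Times_independent:
  obtains B where "B \<subseteq> Rn m \<times> Rn k" "independent B" "card B = m + k"
proof -
  define b :: "nat \<Rightarrow> fvec \<times> fvec"
    where "b i = (if i \<le> m then (unit_vec i, 0) else (0, unit_vec (i - m)))" for i
  define g :: "nat \<Rightarrow> fvec \<times> fvec \<Rightarrow> real"
    where "g i x = (if i \<le> m then coord (fst x) i else coord (snd x) (i - m))" for i x
  have "independent (b ` {1..m + k}) \<and> inj_on b {1..m + k}"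
  proof (rule independent_if_dual[where g = g])
    show "linear (g i)" for i
      by (rule linearI) (auto simp: g_def lookup_add)
  qed (auto simp: g_def b_def)
  moreover have "b ` {1..m + k} \<subseteq> Rn m \<times> Rn k"
    by (auto simp: b_def subspace_0[OF subspace_Rn])
  ultimately show thesis using that by (metis card_atLeastAtMost card_image diff_Suc_1)
qed

text \<open>
  This dimension count is used twice: for the number of constraints of a bounded polyhedron, and
  for the normal of a hyperplane inside a space that is itself a span. If 0 were
  the only common zero, the functionals together would form a linear map injective on the span of
  B, which sends B to card B independent vectors in a space generated by card F vectors.
\<close>

lemma nontrivial_common_kernel:
  fixes f :: "'i \<Rightarrow> 'a::real_vector \<Rightarrow> real"
  assumes fin: "finite F" and lin: "\<And>i. i \<in> F \<Longrightarrow> linear (f i)"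
    and B: "independent B" and card: "card F < card B"
  obtains v where "v \<in> span B" "v \<noteq> 0" "\<And>i. i \<in> F \<Longrightarrow> f i v = 0"
proof -
  define T :: "'a \<Rightarrow> ('i, real) poly_mapping"
    where "T v = (\<Sum>i\<in>F. f i v *\<^sub>R Poly_Mapping.single i 1)" for v
  have lookup_T: "Poly_Mapping.lookup (T v) i = f i v" if "i \<in> F" for v i
  proof -
    have sc: "Poly_Mapping.lookup (r *\<^sub>R x) j = r * Poly_Mapping.lookup x j"
      for r and x :: "('i, real) poly_mapping" and j by (simp add: scaleR_poly_mapping_def)
    show ?thesis unfolding T_def
      using that fin
      by (simp add: lookup_sum sc lookup_single when_def if_distrib[of "\<lambda>c. _ * c"] sum.delta
          cong: if_cong)
  qed
  have "linear T" unfolding T_def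
    by (rule linearI)
      (simp_all add: linear_add[OF lin] linear_scale[OF lin] scaleR_left_distrib sum.distrib
        scaleR_sum_right)
  have "\<not> inj_on T (span B)"
  proof
    assume inj: "inj_on T (span B)"
    have "independent (T ` B)"
      by (rule linear_independent_injective_image[OF \<open>linear T\<close> B inj])
    moreover have "T ` B \<subseteq> span ((\<lambda>i. Poly_Mapping.single i 1) ` F)"
      unfolding T_def by (intro image_subsetI span_sum span_scale) (blast intro: span_base)
    ultimately have "card (T ` B) \<le> card ((\<lambda>i. Poly_Mapping.single i (1::real)) ` F)"
      using independent_span_bound fin by blast
    also have "\<dots> \<le> card F" using fin by (rule card_image_le)
    also have "card (T ` B) = card B"
      by (rule card_image) (meson inj inj_on_subset span_superset)
    finally show False using card by simp
  qed
  then obtain v where "v \<in> span B" "v \<noteq> 0" "T v = 0"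
    using linear_inj_on_iff_eq_0[OF \<open>linear T\<close> subspace_span] by blast
  then show thesis using that lookup_T by (metis lookup_zero)
qed

section \<open>Finitely generated cones\<close>

definition nonneg_combs :: "'a::real_vector set \<Rightarrow> 'a set"
  where "nonneg_combs G = {x. \<exists>u. (\<forall>g\<in>G. 0 \<le> u g) \<and> (\<Sum>g\<in>G. u g *\<^sub>R g) = x}"

lemma nonneg_combs_insert:
  assumes "finite G"
  shows "x \<in> nonneg_combs (insert q G) \<longleftrightarrow> (\<exists>t\<ge>0. x - t *\<^sub>R q \<in> nonneg_combs G)"
proof -
  have "x \<in> nonneg_combs (insert q G) \<longleftrightarrow>
    (\<exists>w u. (\<forall>x\<in>insert q G. 0 \<le> u x) \<and> sum u (insert q G) = w \<and>
       (\<Sum>x\<in>insert q G. u x *\<^sub>R x) = x)"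
    unfolding nonneg_combs_def by simp
  also have "\<dots> \<longleftrightarrow> (\<exists>w. \<exists>t\<ge>0. \<exists>u. (\<forall>x\<in>G. 0 \<le> u x) \<and> sum u G = w - t \<and>
       (\<Sum>x\<in>G. u x *\<^sub>R x) = x - t *\<^sub>R q)"
    by (simp only: convex_hull_finite_step[OF assms])
  also have "\<dots> \<longleftrightarrow> (\<exists>t\<ge>0. x - t *\<^sub>R q \<in> nonneg_combs G)"
  proof
    assume "\<exists>t\<ge>0. x - t *\<^sub>R q \<in> nonneg_combs G"
    then obtain t u where "t \<ge> 0" "\<forall>x\<in>G. 0 \<le> u x" "(\<Sum>x\<in>G. u x *\<^sub>R x) = x - t *\<^sub>R q"
      unfolding nonneg_combs_def by blast
    then show "\<exists>w. \<exists>t\<ge>0. \<exists>u. (\<forall>x\<in>G. 0 \<le> u x) \<and> sum u G = w - t \<and>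
       (\<Sum>x\<in>G. u x *\<^sub>R x) = x - t *\<^sub>R q"
      by - (rule exI[of _ "sum u G + t"], rule exI[of _ t], simp, rule exI[of _ u], simp)
  qed (unfold nonneg_combs_def, blast)
  finally show ?thesis .
qed

lemma interval_between_finite_bounds:
  fixes lo up :: "'a \<Rightarrow> real"
  assumes "finite A" and le: "\<And>a b. a \<in> A \<Longrightarrow> b \<in> B \<Longrightarrow> lo a \<le> up b"
    and nonneg: "\<And>b. b \<in> B \<Longrightarrow> 0 \<le> up b"
  obtains t where "0 \<le> t" "\<And>a. a \<in> A \<Longrightarrow> lo a \<le> t" "\<And>b. b \<in> B \<Longrightarrow> t \<le> up b"
proof (rule that[of "Max (insert 0 (lo ` A))"])
  show "Max (insert 0 (lo ` A)) \<le> up b" if "b \<in> B" for b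
    using that le nonneg \<open>finite A\<close> by auto
qed (use \<open>finite A\<close> in auto)

text \<open>
  The inequalities are updated as in the double description method. A point x lies in the cone
  enlarged by q iff x - t q lies in the old cone for some t \<ge> 0. Each old inequality
  a \<cdot> (x - t q) \<le> 0 bounds t from below or from above, according to the sign of a \<cdot> q, or does
  not restrict it. Eliminating t leaves the inequalities with a \<cdot> q \<le> 0, which for
  a \<cdot> q < 0 say that the upper bound on t is not negative, and one positive combination,
  orthogonal to q, for each pair of a lower and an upper bound.
\<close>

lemma nonneg_combs_polyhedral:
  assumes "finite G" "G \<subseteq> Rn m \<times> Rn k"
  obtains A where "finite A" "A \<subseteq> Rn m \<times> Rn k"
    "nonneg_combs G = {x \<in> Rn m \<times> Rn k. \<forall>a\<in>A. dot_pair m k a x \<le> 0}"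
proof -
  let ?W = "Rn m \<times> Rn k" and ?d = "dot_pair m k"
  have "\<exists>A. finite A \<and> A \<subseteq> ?W \<and> nonneg_combs G = {x \<in> ?W. \<forall>a\<in>A. ?d a x \<le> 0}"
    using assms
  proof (induction G)
    case empty
    \<comment> \<open>The zero cone is cut out by x \<le> 0 and - x \<le> 0 in every coordinate.\<close>
    let ?A = "(\<lambda>j. (unit_vec j, 0)) ` {1..m} \<union> (\<lambda>j. (- unit_vec j, 0)) ` {1..m} \<union>
      (\<lambda>j. (0, unit_vec j)) ` {1..k} \<union> (\<lambda>j. (0, - unit_vec j)) ` {1..k}"
    have neg: "dot d (- unit_vec j) x = - coord x j" if "j \<in> {1..d}" for d j x
      using that by (simp add: dot_commute[of d _ x] linear_neg[OF linear_dot])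
        (simp add: dot_commute[of d x])
    have only0: "x = 0" if x: "x \<in> ?W" "\<forall>a\<in>?A. ?d a x \<le> 0" for x
    proof -
      have "coord (fst x) j = 0" if "j \<in> {1..m}" for j
        using that x(2) by (auto simp: dot_pair_def ball_Un neg intro!: antisym)
      moreover have "coord (snd x) j = 0" if "j \<in> {1..k}" for j
        using that x(2) by (auto simp: dot_pair_def ball_Un neg intro!: antisym)
      ultimately have "fst x = 0" "snd x = 0"
        using x(1) by (auto intro!: Rn_eqI simp: subspace_0[OF subspace_Rn])
      then show ?thesis by (simp add: prod_eq_iff)
    qed
    have zero: "0 \<in> ?W" "\<forall>a\<in>?A. ?d a 0 \<le> 0"
      by (simp_all add: subspace_0[OF subspace_Rn_Times] dot_pair_simps)
    have "nonneg_combs {} = {x \<in> ?W. \<forall>a\<in>?A. ?d a x \<le> 0}"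
    proof (intro equalityI subsetI)
      fix x assume "x \<in> nonneg_combs ({} :: (fvec \<times> fvec) set)"
      then have "x = 0" by (simp add: nonneg_combs_def)
      then show "x \<in> {x \<in> ?W. \<forall>a\<in>?A. ?d a x \<le> 0}"
        using zero by (simp only: mem_Collect_eq)
    next
      fix x assume "x \<in> {x \<in> ?W. \<forall>a\<in>?A. ?d a x \<le> 0}"
      then have "x = 0" by (elim CollectE conjE) (rule only0)
      then show "x \<in> nonneg_combs {}" by (simp add: nonneg_combs_def)
    qed
    moreover have "finite ?A" "?A \<subseteq> ?W"
      by (auto simp: subspace_0[OF subspace_Rn] subspace_neg[OF subspace_Rn])
    ultimately show ?case by (intro exI[of _ ?A] conjI)
  next
    case (insert q G)
    then obtain A where A: "finite A" "A \<subseteq> ?W"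
      "nonneg_combs G = {x \<in> ?W. \<forall>a\<in>A. ?d a x \<le> 0}" by auto
    have q: "q \<in> ?W" using insert.prems by simp
    let ?P = "{a \<in> A. ?d a q > 0}" and ?N = "{a \<in> A. ?d a q < 0}"
    let ?K = "{a \<in> A. ?d a q \<le> 0}"
    define comb where "comb = (\<lambda>(a, b). ?d a q *\<^sub>R b - ?d b q *\<^sub>R a)"
    let ?A = "?K \<union> comb ` (?P \<times> ?N)"
    have comb: "?d (comb (a, b)) x = ?d a q * ?d b x - ?d b q * ?d a x" for a b x
      by (simp add: comb_def dot_pair_simps_left)
    have "finite ?A" using A(1) by simp
    moreover have "?A \<subseteq> ?W"
    proof (rule Un_least)
      show "?K \<subseteq> ?W" using A(2) by blast
      have "comb (a, b) \<in> ?W" if "a \<in> A" "b \<in> A" for a b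
        unfolding comb_def case_prod_conv
        by (intro subspace_diff[OF subspace_Rn_Times] subspace_scale[OF subspace_Rn_Times])
          (use that A(2) in blast)+
      then show "comb ` (?P \<times> ?N) \<subseteq> ?W" by blast
    qed
    moreover have mem: "x \<in> nonneg_combs (insert q G) \<longleftrightarrow> x \<in> ?W \<and> (\<forall>a\<in>?A. ?d a x \<le> 0)" for x
    proof
      assume "x \<in> nonneg_combs (insert q G)"
      then obtain t where t: "0 \<le> t" "x - t *\<^sub>R q \<in> ?W" "\<forall>a\<in>A. ?d a x \<le> t * ?d a q"
        using A(3) by (auto simp: nonneg_combs_insert[OF insert.hyps(1)] dot_pair_simps)
      have "x - t *\<^sub>R q + t *\<^sub>R q \<in> ?W"
        by (intro subspace_add[OF subspace_Rn_Times] subspace_scale[OF subspace_Rn_Times] t q)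
      moreover have "?d a x \<le> 0" if "a \<in> ?K" for a
        using that t by (smt (verit) mem_Collect_eq mult_nonneg_nonpos)
      moreover have "?d (comb (a, b)) x \<le> 0" if "a \<in> ?P" "b \<in> ?N" for a b
      proof -
        have "?d a q * ?d b x \<le> ?d a q * (t * ?d b q)"
          using that t(3) by (intro mult_left_mono) auto
        moreover have "?d b q * (t * ?d a q) \<le> ?d b q * ?d a x"
          using that t(3) by (intro mult_left_mono_neg) auto
        ultimately show ?thesis by (simp add: comb algebra_simps)
      qed
      ultimately show "x \<in> ?W \<and> (\<forall>a\<in>?A. ?d a x \<le> 0)" by auto
    next
      assume x: "x \<in> ?W \<and> (\<forall>a\<in>?A. ?d a x \<le> 0)"
      have "finite ?P" using A(1) by simp
      moreover have "?d a x / ?d a q \<le> ?d b x / ?d b q" if ab: "a \<in> ?P" "b \<in> ?N" for a b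
      proof -
        have "comb (a, b) \<in> ?A" using ab by blast
        then have "?d (comb (a, b)) x \<le> 0" using x by blast
        then have "?d a q * ?d b x \<le> ?d b q * ?d a x" by (simp add: comb)
        then show ?thesis using ab by (simp add: field_simps)
      qed
      moreover have "0 \<le> ?d b x / ?d b q" if "b \<in> ?N" for b
      proof -
        have "?d b x \<le> 0" using x that by auto
        then show ?thesis using that by (simp add: divide_nonpos_neg)
      qed
      ultimately obtain t where t: "0 \<le> t" "\<And>a. a \<in> ?P \<Longrightarrow> ?d a x / ?d a q \<le> t"
        "\<And>b. b \<in> ?N \<Longrightarrow> t \<le> ?d b x / ?d b q"
        using interval_between_finite_bounds[of ?P ?N "\<lambda>a. ?d a x / ?d a q" "\<lambda>b. ?d b x / ?d b q"]
        by blast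
      have "?d a (x - t *\<^sub>R q) \<le> 0" if "a \<in> A" for a
      proof -
        consider "?d a q > 0" | "?d a q < 0" | "?d a q = 0" by linarith
        then have "?d a x \<le> t * ?d a q"
        proof cases
          case 1
          then show ?thesis using t(2)[of a] that by (simp add: pos_divide_le_eq)
        next
          case 2
          then show ?thesis using t(3)[of a] that by (simp add: neg_le_divide_eq)
        next
          case 3
          then show ?thesis using x that by auto
        qed
        then show ?thesis by (simp add: dot_pair_simps)
      qed
      moreover have "x - t *\<^sub>R q \<in> ?W"
        using x q by (intro subspace_diff[OF subspace_Rn_Times] subspace_scale[OF subspace_Rn_Times]) auto
      ultimately show "x \<in> nonneg_combs (insert q G)"
        using A(3) t(1) nonneg_combs_insert[OF insert.hyps(1)] by auto
    qed
    moreover have "nonneg_combs (insert q G) = {x \<in> ?W. \<forall>a\<in>?A. ?d a x \<le> 0}"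
      using mem by (intro set_eqI) (simp only: mem_Collect_eq)
    ultimately show ?case by (intro exI[of _ ?A] conjI)
  qed
  then show thesis using that by blast
qed

section \<open>Counting the constraints of a description\<close>

text \<open>
  Averaging a point that is strict for the constraints treated so far with one that is strict for
  the next constraint keeps all of them strict.
\<close>

lemma common_strict_point:
  assumes "finite I" "convex Q" "Q \<noteq> {}"
    and valid: "\<And>a c x. (a, c) \<in> I \<Longrightarrow> x \<in> Q \<Longrightarrow> dot_pair m k a x \<le> c"
    and strict: "\<And>a c. (a, c) \<in> I \<Longrightarrow> \<exists>x\<in>Q. dot_pair m k a x < c"
  obtains x where "x \<in> Q" "\<And>a c. (a, c) \<in> I \<Longrightarrow> dot_pair m k a x < c"
proof -
  have "\<exists>x\<in>Q. \<forall>(a, c)\<in>I. dot_pair m k a x < c"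
    using assms(1) valid strict
  proof (induction I)
    case empty
    then show ?case using \<open>Q \<noteq> {}\<close> by auto
  next
    case (insert p I)
    obtain a c where p: "p = (a, c)" by fastforce
    obtain x where x: "x \<in> Q" "\<forall>(a, c)\<in>I. dot_pair m k a x < c"
      using insert.IH insert.prems by (meson insertCI)
    obtain y where y: "y \<in> Q" "dot_pair m k a y < c"
      using insert.prems(2) p by blast
    let ?z = "(1/2) *\<^sub>R x + (1/2) *\<^sub>R y"
    have z: "dot_pair m k b ?z = (dot_pair m k b x + dot_pair m k b y) / 2" for b
      by (simp add: dot_pair_simps)
    have "?z \<in> Q"
      by (rule convexD[OF \<open>convex Q\<close> x(1) y(1)]) auto
    moreover have "dot_pair m k b ?z < d" if "(b, d) \<in> insert p I" for b d
    proof (cases "(b, d) = p")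
      case True
      then show ?thesis using y(2) insert.prems(1)[of a c x] x(1) p unfolding z by auto
    next
      case False
      then have "(b, d) \<in> I" using that by auto
      then show ?thesis using x(2) insert.prems(1)[of b d y] y(1) unfolding z by fastforce
    qed
    ultimately show ?case by blast
  qed
  then show thesis using that by blast
qed

text \<open>
  Without equations, a point strict for all inequalities would be interior, so it could be moved a
  little in direction v; but s is constant on Q and not in direction v.
\<close>

lemma describes_needs_equation:
  assumes desc: "describes m k E I Q" and "convex Q" "Q \<noteq> {}"
    and s: "\<And>x. x \<in> Q \<Longrightarrow> dot_pair m k s x = r"
    and v: "v \<in> Rn m \<times> Rn k" "dot_pair m k s v \<noteq> 0"
  shows "E \<noteq> {}"
proof
  assume "E = {}"
  with desc have I: "finite I" "\<forall>(a, c)\<in>I. \<exists>x\<in>Q. dot_pair m k a x < c"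
    and Q: "Q = {x \<in> Rn m \<times> Rn k. \<forall>(a, c)\<in>I. dot_pair m k a x \<le> c}"
    by (auto simp: describes_def)
  obtain x where x: "x \<in> Q" "\<And>a c. (a, c) \<in> I \<Longrightarrow> dot_pair m k a x < c"
    by (rule common_strict_point[OF I(1) assms(2,3)]) (use I(2) Q in auto)
  have "\<forall>\<^sub>F \<epsilon> in at_right 0. \<forall>p\<in>I. dot_pair m k (fst p) (x + \<epsilon> *\<^sub>R v) < snd p"
  proof (rule eventually_ball_finite[OF I(1)], rule ballI)
    fix p assume p: "p \<in> I"
    have "((\<lambda>\<epsilon>. dot_pair m k (fst p) x + \<epsilon> * dot_pair m k (fst p) v) \<longlongrightarrow>
      dot_pair m k (fst p) x + 0 * dot_pair m k (fst p) v) (at_right 0)"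
      by (intro tendsto_intros)
    moreover have "dot_pair m k (fst p) x < snd p" using x(2)[of "fst p" "snd p"] p by simp
    ultimately have "\<forall>\<^sub>F \<epsilon> in at_right 0.
        dot_pair m k (fst p) x + \<epsilon> * dot_pair m k (fst p) v < snd p"
      by (intro order_tendstoD(2)) auto
    then show "\<forall>\<^sub>F \<epsilon> in at_right 0. dot_pair m k (fst p) (x + \<epsilon> *\<^sub>R v) < snd p"
      by (simp add: dot_pair_simps)
  qed
  then have "\<forall>\<^sub>F \<epsilon> in at_right 0. 0 < \<epsilon> \<and> (\<forall>p\<in>I. dot_pair m k (fst p) (x + \<epsilon> *\<^sub>R v) < snd p)"
    using eventually_at_right_less by (rule eventually_conj[rotated])
  then obtain \<epsilon> :: real where \<epsilon>: "0 < \<epsilon>" "\<forall>p\<in>I. dot_pair m k (fst p) (x + \<epsilon> *\<^sub>R v) < snd p"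
    using eventually_happens'[OF trivial_limit_at_right_real] by blast
  have "x + \<epsilon> *\<^sub>R v \<in> Rn m \<times> Rn k"
    using x(1) Q v(1)
    by (intro subspace_add[OF subspace_Rn_Times] subspace_scale[OF subspace_Rn_Times]) auto
  then have "x + \<epsilon> *\<^sub>R v \<in> Q"
    using \<epsilon>(2) unfolding Q by fastforce
  then have "\<epsilon> * dot_pair m k s v = 0"
    using s[OF x(1)] s[of "x + \<epsilon> *\<^sub>R v"] by (simp add: dot_pair_simps)
  then show False using \<epsilon>(1) v(2) by simp
qed

text \<open>
  With fewer constraints, all of them but one inequality have a common direction v \<noteq> 0 in their
  kernel. Either v or - v does not increase the remaining inequality, so Q contains a ray. If there
  is no inequality to leave out, the equations alone must determine a point, and the bound is
  smaller by one.
\<close>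

lemma describes_needs_constraints:
  assumes desc: "describes m k E I Q" and x0: "x0 \<in> Q"
    and no_ray: "\<And>v. v \<in> Rn m \<times> Rn k \<Longrightarrow> (\<And>t. 0 \<le> t \<Longrightarrow> x0 + t *\<^sub>R v \<in> Q) \<Longrightarrow> v = 0"
  shows "m + k < card E + card I \<or> I = {} \<and> m + k \<le> card E"
proof (rule ccontr)
  assume few: "\<not> ?thesis"
  have fin: "finite E" "finite I"
    and Q: "Q = {x \<in> Rn m \<times> Rn k. (\<forall>(a, c)\<in>E. dot_pair m k a x = c) \<and>
      (\<forall>(a, c)\<in>I. dot_pair m k a x \<le> c)}"
    using desc by (auto simp: describes_def)
  obtain B where B: "B \<subseteq> Rn m \<times> Rn k" "independent B" "card B = m + k"
    by (rule Rn_Times_independent)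
  \<comment> \<open>p is the constraint that is left out; for empty I its value does not matter.\<close>
  obtain p where p: "I = {} \<or> p \<in> I" by blast
  have "card (E \<union> (I - {p})) \<le> card E + card (I - {p})" by (rule card_Un_le)
  also have "\<dots> < m + k"
  proof (cases "I = {}")
    case True
    then show ?thesis using few by simp
  next
    case False
    then have "card (I - {p}) = card I - 1" "card I \<ge> 1"
      using p fin by (auto simp: card_Diff_singleton card_gt_0_iff Suc_le_eq)
    then show ?thesis using few by linarith
  qed
  finally have card: "card (E \<union> (I - {p})) < card B" by (simp add: B(3))
  obtain v where v: "v \<in> span B" "v \<noteq> 0"
    "\<And>q. q \<in> E \<union> (I - {p}) \<Longrightarrow> dot_pair m k (fst q) v = 0"
    by (rule nontrivial_common_kernel[where f = "\<lambda>q. dot_pair m k (fst q)",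
          OF _ linear_dot_pair B(2) card]) (use fin in simp, blast)
  define w where "w = (if dot_pair m k (fst p) v \<le> 0 then v else - v)"
  have w0: "w \<noteq> 0" using v(2) by (simp add: w_def)
  have wW: "w \<in> Rn m \<times> Rn k"
  proof -
    have "v \<in> Rn m \<times> Rn k" using v(1) span_minimal[OF B(1) subspace_Rn_Times] by blast
    then show ?thesis using subspace_neg[OF subspace_Rn_Times] unfolding w_def by simp
  qed
  have wE: "dot_pair m k a w = 0" if "(a, c) \<in> E" for a c
    using v(3)[of "(a, c)"] that by (simp add: w_def dot_pair_simps)
  have wI: "dot_pair m k a w \<le> 0" if "(a, c) \<in> I" for a c
  proof (cases "(a, c) = p")
    case True
    then show ?thesis by (auto simp: w_def dot_pair_simps)
  next
    case False
    then show ?thesis using v(3)[of "(a, c)"] that by (simp add: w_def dot_pair_simps)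
  qed
  have "x0 + t *\<^sub>R w \<in> Q" if "0 \<le> t" for t
  proof -
    have "x0 + t *\<^sub>R w \<in> Rn m \<times> Rn k"
      using x0 Q wW
      by (intro subspace_add[OF subspace_Rn_Times] subspace_scale[OF subspace_Rn_Times]) auto
    moreover have "dot_pair m k a (x0 + t *\<^sub>R w) = c" if "(a, c) \<in> E" for a c
      using wE[OF that] x0 that unfolding Q by (auto simp: dot_pair_simps)
    moreover have "dot_pair m k a (x0 + t *\<^sub>R w) \<le> c" if "(a, c) \<in> I" for a c
    proof -
      have "t * dot_pair m k a w \<le> 0"
        using wI[OF that] \<open>0 \<le> t\<close> by (rule mult_nonneg_nonpos[rotated])
      moreover have "dot_pair m k a x0 \<le> c" using x0 that unfolding Q by auto
      ultimately show ?thesis by (simp add: dot_pair_simps)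
    qed
    ultimately show ?thesis unfolding Q by auto
  qed
  then show False using no_ray[OF wW] w0 by blast
qed

section \<open>The embedding as a polytope\<close>

definition embedding_vertices :: "nat \<Rightarrow> (nat \<Rightarrow> fvec) \<Rightarrow> (fvec \<times> fvec) set"
  where "embedding_vertices n H =
    (\<Union>i\<in>{1..n}. {(unit_vec i, H i), (unit_vec (i + 1), H i)})"

lemma unit_vec_in_sos2:
  assumes "i \<in> {1..n}" "j \<in> {i, i + 1}"
  shows "unit_vec j \<in> sos2 n i"
  using assms by (auto simp: sos2_def unit_simplex_def sum.delta)

lemma sos2_decomposition:
  assumes "i \<in> {1..n}" "x \<in> sos2 n i"
  shows "x = coord x i *\<^sub>R unit_vec i + coord x (i + 1) *\<^sub>R unit_vec (i + 1)"
    and "coord x i + coord x (i + 1) = 1"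
proof -
  have x: "x \<in> Rn (n + 1)" "\<forall>j\<in>{1..n + 1} - {i, i + 1}. coord x j = 0"
    "(\<Sum>j=1..n + 1. coord x j) = 1"
    using assms by (auto simp: sos2_def unit_simplex_def intro!: antisym)
  show "x = coord x i *\<^sub>R unit_vec i + coord x (i + 1) *\<^sub>R unit_vec (i + 1)"
  proof (rule Rn_eqI[OF x(1)])
    show "coord x i *\<^sub>R unit_vec i + coord x (i + 1) *\<^sub>R unit_vec (i + 1) \<in> Rn (n + 1)"
      using assms(1) by (intro subspace_add subspace_scale subspace_Rn) auto
    fix j assume "j \<in> {1..n + 1}"
    then show "coord x j = coord (coord x i *\<^sub>R unit_vec i + coord x (i + 1) *\<^sub>R unit_vec (i + 1)) j"
      using x(2) by (auto simp: lookup_add)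
  qed
  have "(\<Sum>j=1..n + 1. coord x j) = (\<Sum>j\<in>{i, i + 1}. coord x j)"
    using assms(1) x(2) by (intro sum.mono_neutral_right) auto
  then show "coord x i + coord x (i + 1) = 1" using x(3) by simp
qed

lemma embedding_sos2_eq: "embedding n (sos2 n) H = convex hull (embedding_vertices n H)"
proof
  have "(x, H i) \<in> convex hull (embedding_vertices n H)" if "i \<in> {1..n}" "x \<in> sos2 n i" for i x
  proof -
    have nonneg: "0 \<le> coord x i" "0 \<le> coord x (i + 1)"
      using that by (auto simp: sos2_def unit_simplex_def)
    have "(unit_vec i, H i) \<in> convex hull (embedding_vertices n H)"
      "(unit_vec (i + 1), H i) \<in> convex hull (embedding_vertices n H)"
      using that(1) by (auto simp: embedding_vertices_def intro!: hull_inc)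
    from convexD[OF convex_convex_hull this nonneg sos2_decomposition(2)[OF that]]
    have "coord x i *\<^sub>R (unit_vec i, H i) + coord x (i + 1) *\<^sub>R (unit_vec (i + 1), H i)
      \<in> convex hull (embedding_vertices n H)" .
    moreover have "coord x i *\<^sub>R (unit_vec i, H i) + coord x (i + 1) *\<^sub>R (unit_vec (i + 1), H i)
      = (x, H i)"
      using sos2_decomposition(1)[OF that] sos2_decomposition(2)[OF that]
      by (simp flip: scaleR_left_distrib)
    ultimately show ?thesis by simp
  qed
  then show "embedding n (sos2 n) H \<subseteq> convex hull (embedding_vertices n H)"
    unfolding embedding_def by (intro hull_minimal) auto
  have "embedding_vertices n H \<subseteq> (\<Union>i\<in>{1..n}. sos2 n i \<times> {H i})"
    using unit_vec_in_sos2 by (auto simp: embedding_vertices_def)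
  then show "convex hull (embedding_vertices n H) \<subseteq> embedding n (sos2 n) H"
    unfolding embedding_def by (rule hull_mono)
qed

text \<open>
  The normal of the equation that the multipliers add up to 1.
\<close>

definition sum_functional :: "nat \<Rightarrow> fvec \<times> fvec"
  where "sum_functional m = (fvec_of m (\<lambda>_. 1), 0)"

lemma dot_sum_functional: "dot_pair m k (sum_functional m) x = (\<Sum>j=1..m. coord (fst x) j)"
  by (simp add: sum_functional_def dot_pair_def)

lemma sum_functional_in: "sum_functional m \<in> Rn m \<times> Rn k"
  by (simp add: sum_functional_def subspace_0[OF subspace_Rn])

lemma finite_embedding_vertices: "finite (embedding_vertices n H)"
  by (simp add: embedding_vertices_def)

lemma embedding_vertices_subset:
  assumes "H \<in> encodings k n"
  shows "embedding_vertices n H \<subseteq> Rn (n + 1) \<times> Rn k"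
  using assms by (auto simp: embedding_vertices_def encodings_def)

lemma sum_functional_vertex:
  "v \<in> embedding_vertices n H \<Longrightarrow> dot_pair (n + 1) k (sum_functional (n + 1)) v = 1"
  unfolding dot_sum_functional by (auto simp: embedding_vertices_def sum.delta)

text \<open>
  All vertices lie on the affine hyperplane where the multipliers add up to 1, so the convex hull is
  a section of the generated cone. Hence descriptions of cones suffice, without a homogenizing
  coordinate.
\<close>

lemma embedding_eq_cone_section:
  assumes "H \<in> encodings k n"
  shows "embedding n (sos2 n) H = {x \<in> nonneg_combs (embedding_vertices n H).
    dot_pair (n + 1) k (sum_functional (n + 1)) x = 1}"
proof -
  let ?V = "embedding_vertices n H"
  define f where "f = dot_pair (n + 1) k (sum_functional (n + 1))"
  have sum: "f (\<Sum>v\<in>?V. u v *\<^sub>R v) = sum u ?V" for u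
    by (simp add: f_def dot_pair_simps sum_functional_vertex[simplified])
  then show ?thesis
    unfolding embedding_sos2_eq convex_hull_finite[OF finite_embedding_vertices] nonneg_combs_def f_def[symmetric]
  proof (intro set_eqI iffI)
    fix x assume "x \<in> {y. \<exists>u. (\<forall>x\<in>?V. 0 \<le> u x) \<and> sum u ?V = 1 \<and> (\<Sum>x\<in>?V. u x *\<^sub>R x) = y}"
    then obtain u where "\<forall>x\<in>?V. 0 \<le> u x" "sum u ?V = 1" "(\<Sum>x\<in>?V. u x *\<^sub>R x) = x" by blast
    then show "x \<in> {x \<in> {x. \<exists>u. (\<forall>g\<in>?V. 0 \<le> u g) \<and> (\<Sum>g\<in>?V. u g *\<^sub>R g) = x}. f x = 1}"
      using sum[of u] by auto
  next
    fix x assume "x \<in> {x \<in> {x. \<exists>u. (\<forall>g\<in>?V. 0 \<le> u g) \<and> (\<Sum>g\<in>?V. u g *\<^sub>R g) = x}. f x = 1}"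
    then obtain u where "\<forall>x\<in>?V. 0 \<le> u x" "f x = 1" "(\<Sum>x\<in>?V. u x *\<^sub>R x) = x" by blast
    then show "x \<in> {y. \<exists>u. (\<forall>x\<in>?V. 0 \<le> u x) \<and> sum u ?V = 1 \<and> (\<Sum>x\<in>?V. u x *\<^sub>R x) = y}"
      using sum[of u] by auto
  qed
qed

text \<open>
  Existence matters because the size is an infimum over the descriptions, and an infimum over the
  empty set of natural numbers would carry no information. Inequalities of the cone that are tight
  on the whole polytope have to be listed as equations.
\<close>

lemma embedding_has_description:
  assumes "H \<in> encodings k n"
  obtains E I where "describes (n + 1) k E I (embedding n (sos2 n) H)"
proof -
  let ?W = "Rn (n + 1) \<times> Rn k" and ?d = "dot_pair (n + 1) k"
  let ?Q = "embedding n (sos2 n) H"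
  obtain A where A: "finite A" "A \<subseteq> ?W"
    "nonneg_combs (embedding_vertices n H) = {x \<in> ?W. \<forall>a\<in>A. ?d a x \<le> 0}"
    using nonneg_combs_polyhedral[OF finite_embedding_vertices embedding_vertices_subset[OF assms]]
    by blast
  define T where "T = {a \<in> A. \<forall>x\<in>?Q. ?d a x = 0}"
  have Q: "x \<in> ?Q \<longleftrightarrow> x \<in> ?W \<and> ?d (sum_functional (n + 1)) x = 1 \<and> (\<forall>a\<in>A. ?d a x \<le> 0)" for x
    unfolding embedding_eq_cone_section[OF assms] A(3) by blast
  let ?E = "insert (sum_functional (n + 1), 1) ((\<lambda>a. (a, 0)) ` T)"
  let ?I = "(\<lambda>a. (a, 0)) ` (A - T)"
  have "describes (n + 1) k ?E ?I ?Q"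
    unfolding describes_def
  proof (intro conjI)
    show "finite ?E" "finite ?I" using A(1) by (auto simp: T_def)
    show "?E \<union> ?I \<subseteq> ?W \<times> UNIV" using A(2) sum_functional_in by (auto simp: T_def)
    show "?Q = {x \<in> ?W. (\<forall>(a, c)\<in>?E. ?d a x = c) \<and> (\<forall>(a, c)\<in>?I. ?d a x \<le> c)}"
    proof (intro set_eqI iffI)
      fix x assume x: "x \<in> ?Q"
      then have "\<forall>a\<in>T. ?d a x = 0" by (simp add: T_def)
      then show "x \<in> {x \<in> ?W. (\<forall>(a, c)\<in>?E. ?d a x = c) \<and> (\<forall>(a, c)\<in>?I. ?d a x \<le> c)}"
        using x unfolding Q by blast
    next
      fix x assume "x \<in> {x \<in> ?W. (\<forall>(a, c)\<in>?E. ?d a x = c) \<and> (\<forall>(a, c)\<in>?I. ?d a x \<le> c)}"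
      then have x: "x \<in> ?W" "?d (sum_functional (n + 1)) x = 1" "\<forall>a\<in>T. ?d a x = 0"
        "\<forall>a\<in>A - T. ?d a x \<le> 0" by auto
      have "?d a x \<le> 0" if "a \<in> A" for a
        using x that by (cases "a \<in> T") auto
      then show "x \<in> ?Q" using x unfolding Q by blast
    qed
    have "\<exists>x\<in>?Q. ?d a x < 0" if a: "a \<in> A - T" for a
    proof -
      obtain x where "x \<in> ?Q" "?d a x \<noteq> 0" using a unfolding T_def by blast
      moreover have "?d a x \<le> 0" using a Q[of x] \<open>x \<in> ?Q\<close> by blast
      ultimately show ?thesis by (intro bexI[of _ x]) simp_all
    qed
    then show "\<forall>(a, c)\<in>?I. \<exists>x\<in>?Q. ?d a x < c" by auto
  qed
  then show thesis by (rule that)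
qed

lemma encoding_zero_one:
  assumes "H \<in> encodings k n" "i \<in> {1..n}"
  shows "coord (H i) j \<in> {0, 1}"
  using assms by (cases "j \<in> {1..k}") (auto simp: encodings_def in_Rn_iff)

lemma embedding_functional_in_convex:
  assumes "linear f" "convex T" "\<And>v. v \<in> embedding_vertices n H \<Longrightarrow> f v \<in> T"
    and "x \<in> embedding n (sos2 n) H"
  shows "f x \<in> T"
proof -
  have "convex (f -` T)"
    using assms(1,2) by (rule convex_linear_vimage)
  then have "convex hull (embedding_vertices n H) \<subseteq> f -` T"
    using assms(3) by (intro hull_minimal) auto
  then show ?thesis using assms(4) by (auto simp: embedding_sos2_eq)
qed

lemma embedding_coord_bounds:
  assumes H: "H \<in> encodings k n" and x: "x \<in> embedding n (sos2 n) H"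
  shows "coord (fst x) j \<in> {0..1}" "coord (snd x) j \<in> {0..1}"
proof -
  show "coord (fst x) j \<in> {0..1}"
    using x by (rule embedding_functional_in_convex[rotated 3])
      (auto intro!: linearI simp: lookup_add embedding_vertices_def)
  have "coord (H i) j \<in> {0..1}" if "i \<in> {1..n}" for i
    using encoding_zero_one[OF H that, of j] by auto
  then show "coord (snd x) j \<in> {0..1}"
    using x by (intro embedding_functional_in_convex[of "\<lambda>x. coord (snd x) j" "{0..1}" n H x])
      (auto intro!: linearI simp: lookup_add embedding_vertices_def)
qed

lemma bounded_on_ray_imp_0:
  fixes a b :: real
  assumes "\<And>t. 0 \<le> t \<Longrightarrow> a + t * b \<in> {0..1}"
  shows "b = 0"
proof (rule ccontr)
  assume "b \<noteq> 0"
  then have "2 / \<bar>b\<bar> * b \<in> {2, - 2}" by (auto simp: abs_if)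
  moreover have "0 \<le> 2 / \<bar>b\<bar>" by simp
  ultimately show False using assms[of 0] assms[of "2 / \<bar>b\<bar>"] by fastforce
qed

lemma embedding_nonempty:
  assumes "n \<ge> 1"
  shows "(unit_vec 1, H 1) \<in> embedding n (sos2 n) H"
  unfolding embedding_sos2_eq embedding_vertices_def using assms by (intro hull_inc) force

text \<open>
  The polytope is bounded since all its coordinates lie between 0 and 1, and it is not
  full-dimensional since the multipliers add up to 1. With m = n + 1 multipliers, boundedness yields
  card E + card I \<ge> (n + 1) + k + 1, and the equation that must be present counts once more. In the
  exceptional case without inequalities, 2 * card E \<ge> 2 * (n + 1 + k) is already enough.
\<close>

lemma description_size_lower_bound:
  assumes n: "n \<ge> 1" and H: "H \<in> encodings k n"
    and desc: "describes (n + 1) k E I (embedding n (sos2 n) H)"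
  shows "n + k + 3 \<le> 2 * card E + card I"
proof -
  let ?Q = "embedding n (sos2 n) H" and ?d = "dot_pair (n + 1) k"
  have "E \<noteq> {}"
  proof (rule describes_needs_equation[OF desc])
    show "convex ?Q" by (simp add: embedding_def)
    show "?Q \<noteq> {}" using embedding_nonempty[OF n] by blast
    show "?d (sum_functional (n + 1)) x = 1" if "x \<in> ?Q" for x
      using that unfolding embedding_eq_cone_section[OF H] by blast
    show "(unit_vec 1, 0) \<in> Rn (n + 1) \<times> Rn k"
      by (simp add: subspace_0[OF subspace_Rn])
    show "?d (sum_functional (n + 1)) (unit_vec 1, 0) \<noteq> 0"
      by (simp add: dot_sum_functional sum.delta)
  qed
  then have "card E \<ge> 1"
    using desc by (auto simp: describes_def card_gt_0_iff Suc_le_eq)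
  moreover have "(n + 1) + k < card E + card I \<or> I = {} \<and> (n + 1) + k \<le> card E"
  proof (rule describes_needs_constraints[OF desc embedding_nonempty[OF n]])
    fix v assume v: "v \<in> Rn (n + 1) \<times> Rn k"
      and ray: "\<And>t. 0 \<le> t \<Longrightarrow> (unit_vec 1, H 1) + t *\<^sub>R v \<in> ?Q"
    have "coord (fst v) j = 0" for j
      using embedding_coord_bounds(1)[OF H ray]
      by (intro bounded_on_ray_imp_0[of "coord (unit_vec 1) j"]) (simp add: lookup_add)
    moreover have "coord (snd v) j = 0" for j
      using embedding_coord_bounds(2)[OF H ray]
      by (intro bounded_on_ray_imp_0[of "coord (H 1) j"]) (simp add: lookup_add)
    ultimately show "v = 0" by (intro prod_eqI poly_mapping_eqI) simp_all
  qed
  ultimately show ?thesis using n by auto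
qed

section \<open>Hyperplanes spanned by the differences\<close>

text \<open>
  The differences to the first code are partial sums of the consecutive differences.
\<close>

lemma lin_space_eq_span:
  assumes "n \<ge> 1"
  shows "lin_space n H = span (diffs n H)"
proof -
  let ?D = "{x - H 1 | x. x \<in> H ` {1..n} - {H 1}}"
  have "H 1 \<in> H ` {1..n}" using assms by simp
  then have "lin_space n H = span ?D"
    unfolding lin_space_def affine_hull_span[OF \<open>H 1 \<in> _\<close>] by force
  also have "\<dots> = span (diffs n H)"
  proof (rule span_eq[THEN iffD2], intro conjI subsetI)
    have tele: "H i - H 1 \<in> span (diffs n H)" if "1 \<le> i" "i \<le> n" for i
      using that
    proof (induction i rule: dec_induct)
      case base
      then show ?case by (simp add: span_zero)
    next
      case (step i)
      then have "H (i + 1) - H i \<in> span (diffs n H)"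
        by (intro span_base) (auto simp: diffs_def)
      moreover have "H i - H 1 \<in> span (diffs n H)" using step by simp
      ultimately have "(H (i + 1) - H i) + (H i - H 1) \<in> span (diffs n H)" by (rule span_add)
      then show ?case by simp
    qed
    fix x assume "x \<in> ?D"
    then show "x \<in> span (diffs n H)" using tele by auto
  next
    fix x assume "x \<in> diffs n H"
    then obtain i where i: "i \<in> {1..<n}" "x = H (i + 1) - H i" by (auto simp: diffs_def)
    have "H j - H 1 \<in> span ?D" if "j \<in> {1..n}" for j
      using that by (cases "H j = H 1") (auto simp: span_zero intro!: span_base)
    from span_diff[OF this[of "i + 1"] this[of i]]
    show "x \<in> span ?D" using i by simp
  qed
  finally show ?thesis .
qed

lemma finite_diffs: "finite (diffs n H)"
  by (simp add: diffs_def)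

lemma diffs_subset_Rn:
  assumes "H \<in> encodings k n"
  shows "diffs n H \<subseteq> Rn k"
  using assms by (auto simp: diffs_def encodings_def intro!: subspace_diff[OF subspace_Rn])

lemma finite_spanned_hyperplanes: "finite (spanned_hyperplanes n k H)"
proof (rule finite_subset)
  show "spanned_hyperplanes n k H \<subseteq> span ` Pow (diffs n H)"
    by (auto simp: spanned_hyperplanes_def)
qed (simp add: finite_diffs)

text \<open>
  Leaving out one element of a basis taken from the differences spans a hyperplane, and different
  elements give different hyperplanes. The normal has to lie in the span of the basis itself; it
  exists because it solves one homogeneous equation fewer than the dimension.
\<close>

lemma card_basis_le_spanned_hyperplanes:
  assumes n: "n \<ge> 1" and H: "H \<in> encodings k n"
    and B: "B \<subseteq> diffs n H" "independent B" "diffs n H \<subseteq> span B"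
  shows "card B \<le> card (spanned_hyperplanes n k H)"
proof -
  have fin: "finite B" using B(1) finite_diffs by (rule finite_subset)
  have L: "lin_space n H = span B"
    unfolding lin_space_eq_span[OF n]
    using span_minimal[OF B(3) subspace_span] span_mono[OF B(1)] by (rule antisym)
  have BR: "span B \<subseteq> Rn k"
    using B(1) diffs_subset_Rn[OF H] by (intro span_minimal subspace_Rn) blast
  have "span (B - {c}) \<in> spanned_hyperplanes n k H" if c: "c \<in> B" for c
  proof -
    have card: "card (B - {c}) < card B" using fin c by (rule card_Diff1_less)
    obtain b where b: "b \<in> span B" "b \<noteq> 0" "\<And>a. a \<in> B - {c} \<Longrightarrow> dot k a b = 0"
      by (rule nontrivial_common_kernel[where f = "dot k", OF _ linear_dot B(2) card])
        (use fin in simp, blast)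
    have perp: "dot k b y = 0" if "y \<in> span (B - {c})" for y
      by (rule linear_eq_0_on_span[OF linear_dot _ that]) (use b(3) dot_commute in metis)
    have bc: "dot k b c \<noteq> 0"
    proof
      assume "dot k b c = 0"
      then have "dot k b a = 0" if "a \<in> B" for a
        using that b(3)[of a] by (cases "a = c") (auto simp: dot_commute)
      then have "dot k b b = 0"
        by (rule linear_eq_0_on_span[OF linear_dot _ b(1)])
      then show False using dot_self_eq_0 b(1,2) BR by blast
    qed
    have "hyperplane n k H b = span (B - {c})"
      unfolding hyperplane_def L
    proof (intro equalityI subsetI CollectI conjI)
      fix y assume "y \<in> {y \<in> span B. dot k b y = 0}"
      then have y: "y \<in> span (insert c (B - {c}))" "dot k b y = 0"
        using c by (auto simp: insert_absorb)
      then obtain r where r: "y - r *\<^sub>R c \<in> span (B - {c})"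
        unfolding span_breakdown_eq by blast
      have "dot k b y - r * dot k b c = 0"
        using perp[OF r] by (simp add: linear_diff[OF linear_dot] linear_scale[OF linear_dot])
      then have "r = 0" using y(2) bc by simp
      then show "y \<in> span (B - {c})" using r by simp
    next
      fix y assume y: "y \<in> span (B - {c})"
      then show "y \<in> span B" using span_mono[of "B - {c}" B] by blast
      show "dot k b y = 0" using y by (rule perp)
    qed
    then show ?thesis
      using b(1,2) B(1) L unfolding spanned_hyperplanes_def by blast
  qed
  moreover have "inj_on (\<lambda>c. span (B - {c})) B"
  proof (rule inj_onI, rule ccontr)
    fix c c' assume c: "c \<in> B" "c' \<in> B" "span (B - {c}) = span (B - {c'})" "c \<noteq> c'"
    then have "c \<in> span (B - {c'})" by (intro span_base) simp
    then show False using c(1,3) B(2) by (auto simp: dependent_def)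
  qed
  ultimately show ?thesis
    by (intro card_inj_on_le[of "\<lambda>c. span (B - {c})"] finite_spanned_hyperplanes) auto
qed

text \<open>
  A flat of dimension d contains at most 2 ^ d points with coordinates 0 and 1: a coordinate that is
  not constant on A splits A into two parts, and the differences within each part lie in a proper
  subspace of V. The dimension bound on V is stated as a bound on its independent subsets, which is
  immediate to pass on to that subspace: x - y can be added to any independent subset of it.
\<close>

lemma card_zero_one_points_le:
  assumes "finite A" "subspace V"
    and "\<And>x y. x \<in> A \<Longrightarrow> y \<in> A \<Longrightarrow> x - y \<in> V"
    and "\<And>x j. x \<in> A \<Longrightarrow> coord x j \<in> {0, 1}"
    and "\<And>B. B \<subseteq> V \<Longrightarrow> independent B \<Longrightarrow> finite B \<and> card B \<le> d"
  shows "card A \<le> 2 ^ d"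
  using assms
proof (induction d arbitrary: A V)
  case 0
  have "x = y" if "x \<in> A" "y \<in> A" for x y
  proof (rule ccontr)
    assume "x \<noteq> y"
    then have "independent {x - y}" by simp
    moreover have "{x - y} \<subseteq> V" using "0.prems"(3)[OF that] by simp
    ultimately show False using "0.prems"(5)[of "{x - y}"] by simp
  qed
  then have "card A \<le> 1" using "0.prems"(1) by (metis card_le_Suc0_iff_eq One_nat_def)
  then show ?case by simp
next
  case (Suc d)
  show ?case
  proof (cases "\<exists>x\<in>A. \<exists>y\<in>A. x \<noteq> y")
    case False
    then have "card A \<le> 1" using Suc.prems(1) by (metis card_le_Suc0_iff_eq One_nat_def)
    also have "1 \<le> (2::nat) ^ Suc d" by simp
    finally show ?thesis .
  next
    case True
    then obtain x y where xy: "x \<in> A" "y \<in> A" "x \<noteq> y" by blast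
    then obtain j where j: "coord (x - y) j \<noteq> 0"
      by (metis eq_iff_diff_eq_0 lookup_zero poly_mapping_eqI)
    let ?V = "V \<inter> {z. coord z j = 0}"
    have sub: "subspace {z. coord z j = 0}"
      by (auto simp: subspace_def lookup_add)
    have half: "card {z \<in> A. coord z j = c} \<le> 2 ^ d" for c
    proof (rule Suc.IH[of _ ?V])
      show "subspace ?V" using Suc.prems(2) sub by (rule subspace_inter)
      show "z - z' \<in> ?V" if "z \<in> {z \<in> A. coord z j = c}" "z' \<in> {z \<in> A. coord z j = c}" for z z'
        using that Suc.prems(3) by (auto simp: lookup_minus)
      fix B assume B: "B \<subseteq> ?V" "independent B"
      have "span B \<subseteq> {z. coord z j = 0}" using B(1) by (intro span_minimal sub) auto
      then have v: "x - y \<notin> span B" using j by blast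
      then have "independent (insert (x - y) B)" using B(2) by (rule independent_insertI)
      then have "finite (insert (x - y) B) \<and> card (insert (x - y) B) \<le> Suc d"
        using B(1) Suc.prems(3)[OF xy(1,2)] by (intro Suc.prems(5)) auto
      moreover have "x - y \<notin> B" using v span_base by blast
      ultimately show "finite B \<and> card B \<le> d" by (auto simp: card_insert_if)
    qed (use Suc.prems in auto)
    have "A = {z \<in> A. coord z j = 0} \<union> {z \<in> A. coord z j = 1}"
      using Suc.prems(4) by auto
    then have "card A = card ({z \<in> A. coord z j = 0} \<union> {z \<in> A. coord z j = 1})"
      by (rule arg_cong)
    also have "\<dots> \<le> card {z \<in> A. coord z j = 0} + card {z \<in> A. coord z j = 1}"
      by (rule card_Un_le)
    also have "\<dots> \<le> 2 ^ d + 2 ^ d" by (intro add_mono half)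
    finally show ?thesis by simp
  qed
qed

lemma ceiling_log2_le:
  assumes "n \<ge> 1" "n \<le> 2 ^ d"
  shows "\<lceil>log 2 (real n)\<rceil> \<le> int d"
proof -
  have "real n \<le> 2 ^ d" using assms(2) by (metis of_nat_le_iff of_nat_numeral of_nat_power)
  then have "log 2 (real n) \<le> real d" using assms(1) by (intro log_of_power_le) auto
  then show ?thesis by (simp add: ceiling_le_iff)
qed

lemma ceiling_log2_le_card_spanned_hyperplanes:
  assumes n: "n \<ge> 1" and H: "H \<in> encodings k n"
  shows "\<lceil>log 2 (real n)\<rceil> \<le> int (card (spanned_hyperplanes n k H))"
proof -
  obtain B where B: "B \<subseteq> diffs n H" "independent B" "diffs n H \<subseteq> span B"
    by (rule maximal_independent_subset)
  have fin: "finite B" using B(1) finite_diffs by (rule finite_subset)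
  have L: "lin_space n H = span B"
    unfolding lin_space_eq_span[OF n]
    using span_minimal[OF B(3) subspace_span] span_mono[OF B(1)] by (rule antisym)
  have "card (H ` {1..n}) \<le> 2 ^ card B"
  proof (rule card_zero_one_points_le)
    show "subspace (span B)" by (rule subspace_span)
    show "x - y \<in> span B" if "x \<in> H ` {1..n}" "y \<in> H ` {1..n}" for x y
    proof -
      have "x - H 1 \<in> span B" "y - H 1 \<in> span B"
        using that unfolding L[symmetric] lin_space_def by (auto intro: hull_inc)
      then have "(x - H 1) - (y - H 1) \<in> span B" by (rule span_diff)
      then show ?thesis by simp
    qed
    show "coord x j \<in> {0, 1}" if "x \<in> H ` {1..n}" for x j
      using that encoding_zero_one[OF H] by blast
    show "finite C \<and> card C \<le> card B" if "C \<subseteq> span B" "independent C" for C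
      using independent_span_bound[OF fin that(2,1)] .
  qed simp
  moreover have "card (H ` {1..n}) = n"
    using H by (simp add: encodings_def card_image)
  ultimately have "\<lceil>log 2 (real n)\<rceil> \<le> int (card B)" using n by (intro ceiling_log2_le) simp_all
  then show ?thesis
    using card_basis_le_spanned_hyperplanes[OF n H B] by linarith
qed

section \<open>Encodings that change one coordinate at a time\<close>

text \<open>
  The condition that every coordinate changes somewhere makes the differences span the whole space
  and keeps the general inequalities from being equations on the polytope.
\<close>

definition gray_encoding :: "nat \<Rightarrow> nat \<Rightarrow> (nat \<Rightarrow> fvec) \<Rightarrow> bool"
  where "gray_encoding k n H \<longleftrightarrow> H \<in> encodings k n \<and>
    (\<forall>i\<in>{1..<n}. \<exists>l. \<forall>l'. l' \<noteq> l \<longrightarrow> coord (H (i + 1)) l' = coord (H i) l') \<and>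
    (\<forall>l\<in>{1..k}. \<exists>i\<in>{1..<n}. coord (H (i + 1)) l \<noteq> coord (H i) l)"

text \<open>
  Bit l of the reflected binary Gray code of i. The usual form, i XOR (i div 2), gives the same bits.
\<close>

definition gray_bit :: "nat \<Rightarrow> nat \<Rightarrow> nat"
  where "gray_bit l i = ((i + 2 ^ l) div 2 ^ (l + 1)) mod 2"

text \<open>
  The bit l changes between i and i + 1 iff 2 ^ l is the exact power of 2 in i + 1; this is why one
  bit changes at each step.
\<close>

lemma gray_bit_flips_iff: "gray_bit l (Suc i) \<noteq> gray_bit l i \<longleftrightarrow> 2 ^ (l + 1) dvd Suc i + 2 ^ l"
proof -
  have "(Suc m div d) mod 2 \<noteq> (m div d) mod 2 \<longleftrightarrow> Suc m mod d = 0" for m d :: nat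
  proof (cases "Suc m mod d = 0")
    case True
    then have "Suc m div d = Suc (m div d)" by (simp add: div_Suc)
    moreover have "Suc q mod 2 \<noteq> q mod 2" for q :: nat by presburger
    ultimately show ?thesis using True by metis
  next
    case False
    then have "Suc m div d = m div d" by (simp add: div_Suc)
    then show ?thesis using False by simp
  qed
  from this[of "i + 2 ^ l" "2 ^ (l + 1)"] show ?thesis
    unfolding gray_bit_def dvd_eq_mod_eq_0 by (simp only: add_Suc)
qed

lemma gray_bit_flips_unique:
  assumes "gray_bit l (Suc i) \<noteq> gray_bit l i" "gray_bit l' (Suc i) \<noteq> gray_bit l' i"
  shows "l = l'"
proof -
  have no_smaller: False
    if "l < l'" "2 ^ (l + 1) dvd Suc i + 2 ^ l" "2 ^ (l' + 1) dvd Suc i + 2 ^ l'" for l l'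
  proof -
    have "(2::nat) ^ (l + 1) dvd 2 ^ l'" using that(1) by (intro le_imp_power_dvd) simp
    moreover have "(2::nat) ^ (l + 1) dvd Suc i + 2 ^ l'"
      by (rule dvd_trans[OF _ that(3)]) (use that(1) in \<open>intro le_imp_power_dvd, simp\<close>)
    ultimately have "(2::nat) ^ (l + 1) dvd Suc i" by (simp only: dvd_add_left_iff)
    then have "(2::nat) ^ (l + 1) dvd 2 ^ l" using that(2) by (simp only: dvd_add_right_iff)
    then show False by (auto dest: power_dvd_imp_le)
  qed
  show ?thesis
    using assms no_smaller[of l l'] no_smaller[of l' l] unfolding gray_bit_flips_iff
    by (meson linorder_neqE_nat)
qed

text \<open>
  The number is recovered from its most significant end: half of i div 2 ^ l is i div 2 ^ (l + 1),
  and the Gray bit l then determines the parity of i div 2 ^ l.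
\<close>

lemma gray_bit_inj:
  assumes "i < 2 ^ k" "i' < 2 ^ k" and bits: "\<And>l. l < k \<Longrightarrow> gray_bit l i = gray_bit l i'"
  shows "i = i'"
proof -
  have "i div 2 ^ l = i' div 2 ^ l" if "l \<le> k" for l
    using that
  proof (induction l rule: inc_induct)
    case base
    then show ?case using assms(1,2) by simp
  next
    case (step l)
    have half: "j div 2 ^ Suc l = j div 2 ^ l div 2" for j :: nat
      by (simp only: power_Suc2 div_mult2_eq)
    have "(j + 2 ^ l) div 2 ^ (l + 1) = (j div 2 ^ l + 1) div 2" for j :: nat
      using half[of "j + 2 ^ l"] by simp
    then have "((i div 2 ^ l + 1) div 2) mod 2 = ((i' div 2 ^ l + 1) div 2) mod 2"
      using bits[of l] step.hyps by (simp add: gray_bit_def)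
    moreover have "i div 2 ^ l div 2 = i' div 2 ^ l div 2"
      using step.IH by (simp only: half)
    moreover have "a = b" if "((a + 1) div 2) mod 2 = ((b + 1) div 2) mod 2" "a div 2 = b div 2"
      for a b :: nat
    proof -
      have split: "(c + 1) div 2 = c div 2 + c mod 2" for c :: nat by presburger
      have parity: "Suc c mod 2 \<noteq> c mod 2" for c :: nat by presburger
      have "(a div 2 + a mod 2) mod 2 = (a div 2 + b mod 2) mod 2"
        using that by (simp only: split)
      then have "a mod 2 = b mod 2"
        using parity[of "a div 2"] by (cases "a mod 2 = 0"; cases "b mod 2 = 0") simp_all
      then show "a = b" using that(2) by (metis div_mult_mod_eq)
    qed
    ultimately show ?case by blast
  qed
  from this[of 0] show ?thesis by simp
qed

text \<open>
  The first n words of the reflected Gray code. Coordinate l flips for the first time after word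
  2 ^ (l - 1), which is among the n words because 2 ^ (k - 1) < n.
\<close>

lemma gray_encoding_exists:
  assumes n: "n \<ge> 1" "n \<le> 2 ^ k" and k: "k = 0 \<or> 2 ^ (k - 1) < n"
  obtains H where "gray_encoding k n H"
proof
  define H where "H i = fvec_of k (\<lambda>l. real (gray_bit (l - 1) (i - 1)))" for i
  have coord_H: "coord (H i) l = (if l \<in> {1..k} then real (gray_bit (l - 1) (i - 1)) else 0)" for i l
    by (simp add: H_def coord_fvec_of)
  have "inj_on H {1..n}"
  proof (rule inj_onI)
    fix i i' assume i: "i \<in> {1..n}" "i' \<in> {1..n}" "H i = H i'"
    have "i - 1 = i' - 1"
    proof (rule gray_bit_inj)
      fix l assume "l < k"
      then have "Suc l \<in> {1..k}" by simp
      then show "gray_bit l (i - 1) = gray_bit l (i' - 1)"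
        using coord_H[of i "Suc l"] coord_H[of i' "Suc l"] i(3) by simp
    qed (use i n in auto)
    then show "i = i'" using i by auto
  qed
  moreover have "coord (H i) l \<in> {0, 1}" for i l
    unfolding coord_H gray_bit_def by auto
  moreover have "H i \<in> Rn k" for i by (simp add: H_def)
  ultimately have "H \<in> encodings k n" by (simp add: encodings_def)
  moreover have "\<exists>l. \<forall>l'. l' \<noteq> l \<longrightarrow> coord (H (i + 1)) l' = coord (H i) l'" if "i \<in> {1..<n}" for i
  proof -
    have i: "i = Suc (i - 1)" using that by simp
    have "l = l'" if "coord (H (i + 1)) l \<noteq> coord (H i) l" "coord (H (i + 1)) l' \<noteq> coord (H i) l'"
      for l l'
    proof -
      have "l \<in> {1..k}" "l' \<in> {1..k}" using that by (auto simp: coord_H split: if_splits)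
      moreover from this have "l - 1 = l' - 1"
        using that gray_bit_flips_unique[of "l - 1" "i - 1" "l' - 1"] i
        by (auto simp: coord_H)
      ultimately show ?thesis by auto
    qed
    then show ?thesis by blast
  qed
  moreover have "\<exists>i\<in>{1..<n}. coord (H (i + 1)) l \<noteq> coord (H i) l" if l: "l \<in> {1..k}" for l
  proof
    let ?i = "2 ^ (l - 1) :: nat"
    have "?i \<le> 2 ^ (k - 1)" using l by (intro power_increasing) auto
    also have "2 ^ (k - 1) < n" using k l by auto
    finally show "?i \<in> {1..<n}" by simp
    have "2 ^ (l - 1 + 1) dvd ?i + 2 ^ (l - 1)" by (simp flip: mult_2)
    then have "gray_bit (l - 1) (Suc (?i - 1)) \<noteq> gray_bit (l - 1) (?i - 1)"
      unfolding gray_bit_flips_iff by simp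
    then show "coord (H (?i + 1)) l \<noteq> coord (H ?i) l"
      using l by (simp add: coord_H)
  qed
  ultimately show "gray_encoding k n H" by (simp add: gray_encoding_def)
qed

lemma gray_encoding_diff:
  assumes H: "gray_encoding k n H" and s: "s \<in> diffs n H"
  obtains l r where "l \<in> {1..k}" "r \<noteq> 0" "s = r *\<^sub>R unit_vec l"
proof -
  obtain i where i: "i \<in> {1..<n}" "s = H (i + 1) - H i" using s by (auto simp: diffs_def)
  obtain l where l: "\<And>l'. l' \<noteq> l \<Longrightarrow> coord (H (i + 1)) l' = coord (H i) l'"
    using H i(1) unfolding gray_encoding_def by blast
  have enc: "H \<in> encodings k n" using H by (simp add: gray_encoding_def)
  have s_eq: "s = coord s l *\<^sub>R unit_vec l"
    using l by (intro poly_mapping_eqI) (auto simp: i(2) lookup_minus)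
  have "s \<noteq> 0"
    using enc i by (auto simp: encodings_def dest: inj_onD)
  then have "coord s l \<noteq> 0" using s_eq by force
  moreover have "l \<in> {1..k}"
    using \<open>coord s l \<noteq> 0\<close> subsetD[OF diffs_subset_Rn[OF enc] s] unfolding in_Rn_iff by blast
  ultimately show thesis using that s_eq by blast
qed

text \<open>
  All differences are multiples of unit vectors, so a spanned hyperplane is a coordinate hyperplane.
  If its normal b has a nonzero coordinate l, then no vector of the spanning set, hence none of the
  hyperplane, has a nonzero coordinate l. A second nonzero coordinate l' of b would contradict this:
  the vector with entry b l' at l and entry - b l at l' is orthogonal to b.
\<close>

lemma card_spanned_hyperplanes_gray:
  assumes n: "n \<ge> 1" and H: "gray_encoding k n H"
  shows "card (spanned_hyperplanes n k H) \<le> k"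
proof -
  have enc: "H \<in> encodings k n" using H by (simp add: gray_encoding_def)
  have L: "lin_space n H = span (diffs n H)" using n by (rule lin_space_eq_span)
  have LR: "lin_space n H \<subseteq> Rn k"
    unfolding L using diffs_subset_Rn[OF enc] by (intro span_minimal subspace_Rn)
  have unit: "unit_vec l \<in> lin_space n H" if l: "l \<in> {1..k}" for l
  proof -
    obtain i where i: "i \<in> {1..<n}" "coord (H (i + 1)) l \<noteq> coord (H i) l"
      using H l unfolding gray_encoding_def by blast
    have s: "H (i + 1) - H i \<in> diffs n H" using i(1) by (auto simp: diffs_def)
    obtain l' r where lr: "r \<noteq> 0" "H (i + 1) - H i = r *\<^sub>R unit_vec l'"
      using gray_encoding_diff[OF H s] by metis
    have "coord (H (i + 1) - H i) l \<noteq> 0" using i(2) by (simp add: lookup_minus)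
    then have "l' = l" unfolding lr(2) by (auto split: if_splits)
    then have "unit_vec l = inverse r *\<^sub>R (H (i + 1) - H i)" using lr by simp
    then show ?thesis unfolding L using span_scale[OF span_base[OF s]] by simp
  qed
  have "spanned_hyperplanes n k H \<subseteq> (\<lambda>l. {y \<in> lin_space n H. coord y l = 0}) ` {1..k}"
  proof
    fix M assume "M \<in> spanned_hyperplanes n k H"
    then obtain b S where b: "b \<in> lin_space n H" "b \<noteq> 0" and M: "M = hyperplane n k H b"
      and S: "S \<subseteq> diffs n H" "M = span S"
      by (auto simp: spanned_hyperplanes_def)
    have bR: "b \<in> Rn k" using b(1) LR by blast
    then obtain l where l: "l \<in> {1..k}" "coord b l \<noteq> 0"
      using b(2) by (metis in_Rn_iff lookup_zero poly_mapping_eqI)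
    have "coord s l = 0" if s: "s \<in> S" for s
    proof -
      obtain l' r where lr: "l' \<in> {1..k}" "s = r *\<^sub>R unit_vec l'"
        using gray_encoding_diff[OF H] S(1) s by (metis subsetD)
      have "dot k b s = 0"
        using s S(2) span_base unfolding M hyperplane_def by blast
      then have "r * coord b l' = 0"
        unfolding lr(2) linear_scale[OF linear_dot] dot_unit_vec_right[OF lr(1)] by simp
      then show ?thesis using l(2) lr(2) by auto
    qed
    then have "span S \<subseteq> {z. coord z l = 0}"
      by (intro span_minimal) (auto simp: subspace_def lookup_add)
    then have M0: "coord y l = 0" if "y \<in> M" for y using that S(2) by blast
    have b_l: "coord b l' = 0" if "l' \<in> {1..k}" "l' \<noteq> l" for l'
    proof -
      let ?y = "coord b l' *\<^sub>R unit_vec l - coord b l *\<^sub>R unit_vec l'"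
      have "?y \<in> lin_space n H"
        unfolding L using unit[OF l(1)] unit[OF that(1)] unfolding L
        by (intro span_diff span_scale)
      moreover have "dot k b ?y = 0"
        using l(1) that(1)
        by (simp add: linear_diff[OF linear_dot] linear_scale[OF linear_dot] dot_unit_vec_right)
      ultimately have "?y \<in> M" by (simp add: M hyperplane_def)
      then have "coord ?y l = 0" by (rule M0)
      then show ?thesis using that(2) by (simp add: lookup_minus)
    qed
    have "dot k b y = coord b l * coord y l" for y
      unfolding dot_def using l(1) b_l by (subst sum.remove[of _ l]) auto
    then have "M = {y \<in> lin_space n H. coord y l = 0}"
      using l(2) by (auto simp: M hyperplane_def)
    then show "M \<in> (\<lambda>l. {y \<in> lin_space n H. coord y l = 0}) ` {1..k}" using l(1) by blast
  qed
  then have "card (spanned_hyperplanes n k H) \<le> card ((\<lambda>l. {y \<in> lin_space n H. coord y l = 0}) ` {1..k})"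
    by (intro card_mono) auto
  also have "\<dots> \<le> card {1..k}" by (rule card_image_le) simp
  finally show ?thesis by simp
qed

section \<open>The general inequalities of a Gray encoding\<close>

text \<open>
  The vertices over the unit vector j carry the codes j - 1 and j, read as the codes 1 and n at the
  two ends of the range.
\<close>

definition left_code :: "(nat \<Rightarrow> fvec) \<Rightarrow> nat \<Rightarrow> fvec"
  where "left_code H j = H (max 1 (j - 1))"

definition right_code :: "nat \<Rightarrow> (nat \<Rightarrow> fvec) \<Rightarrow> nat \<Rightarrow> fvec"
  where "right_code n H j = H (min n j)"

definition lower_coeff :: "nat \<Rightarrow> (nat \<Rightarrow> fvec) \<Rightarrow> nat \<Rightarrow> nat \<Rightarrow> real"
  where "lower_coeff n H l j = min (coord (left_code H j) l) (coord (right_code n H j) l)"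

definition upper_coeff :: "nat \<Rightarrow> (nat \<Rightarrow> fvec) \<Rightarrow> nat \<Rightarrow> nat \<Rightarrow> real"
  where "upper_coeff n H l j = max (coord (left_code H j) l) (coord (right_code n H j) l)"

lemma embedding_vertexI:
  "i \<in> {1..n} \<Longrightarrow> j = i \<or> j = i + 1 \<Longrightarrow> (unit_vec j, H i) \<in> embedding_vertices n H"
  by (auto simp: embedding_vertices_def)

lemma left_right_vertices:
  assumes n: "n \<ge> 1" and j: "j \<in> {1..n + 1}"
  shows "(unit_vec j, left_code H j) \<in> embedding_vertices n H"
    and "(unit_vec j, right_code n H j) \<in> embedding_vertices n H"
proof -
  have "max 1 (j - 1) \<in> {1..n}" "j = max 1 (j - 1) \<or> j = max 1 (j - 1) + 1"
    using n j by auto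
  then show "(unit_vec j, left_code H j) \<in> embedding_vertices n H"
    unfolding left_code_def by (rule embedding_vertexI)
  have "min n j \<in> {1..n}" "j = min n j \<or> j = min n j + 1"
    using n j by auto
  then show "(unit_vec j, right_code n H j) \<in> embedding_vertices n H"
    unfolding right_code_def by (rule embedding_vertexI)
qed

lemma embedding_vertex_cases:
  assumes "v \<in> embedding_vertices n H"
  obtains j where "j \<in> {1..n + 1}" "fst v = unit_vec j" "snd v \<in> {left_code H j, right_code n H j}"
proof -
  obtain i where i: "i \<in> {1..n}" "v = (unit_vec i, H i) \<or> v = (unit_vec (i + 1), H i)"
    using assms by (auto simp: embedding_vertices_def)
  have "H i = right_code n H i" "H i = left_code H (i + 1)"
    using i(1) by (auto simp: right_code_def left_code_def min_def max_def)
  then show thesis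
    using i that[of i] that[of "i + 1"] by auto
qed

lemma gray_left_right:
  assumes n: "n \<ge> 1" and H: "gray_encoding k n H" and j: "j \<in> {1..n + 1}"
  obtains l where "\<And>l'. l' \<noteq> l \<Longrightarrow> coord (left_code H j) l' = coord (right_code n H j) l'"
proof -
  consider "j = 1" | "j = n + 1" | "j - 1 \<in> {1..<n}" "j = (j - 1) + 1" using j by force
  then show thesis
  proof cases
    case 1
    then show thesis using n by (intro that[of 0]) (simp add: left_code_def right_code_def)
  next
    case 2
    then show thesis
      using n by (intro that[of 0]) (simp add: left_code_def right_code_def max_def)
  next
    case 3
    then obtain l where "\<And>l'. l' \<noteq> l \<Longrightarrow> coord (H (j - 1 + 1)) l' = coord (H (j - 1)) l'"
      using H unfolding gray_encoding_def by blast
    moreover have "left_code H j = H (j - 1)" "right_code n H j = H (j - 1 + 1)"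
      using 3 j by (auto simp: left_code_def right_code_def)
    ultimately show thesis by (intro that[of l]) simp
  qed
qed

definition bound_constraints :: "nat \<Rightarrow> ((fvec \<times> fvec) \<times> real) set"
  where "bound_constraints n = (\<lambda>j. ((- unit_vec j, 0), 0)) ` {1..n + 1}"

definition lower_constraints :: "nat \<Rightarrow> nat \<Rightarrow> (nat \<Rightarrow> fvec) \<Rightarrow> ((fvec \<times> fvec) \<times> real) set"
  where "lower_constraints n k H =
    (\<lambda>l. ((fvec_of (n + 1) (lower_coeff n H l), - unit_vec l), 0)) ` {1..k}"

definition upper_constraints :: "nat \<Rightarrow> nat \<Rightarrow> (nat \<Rightarrow> fvec) \<Rightarrow> ((fvec \<times> fvec) \<times> real) set"
  where "upper_constraints n k H =
    (\<lambda>l. ((- fvec_of (n + 1) (upper_coeff n H l), unit_vec l), 0)) ` {1..k}"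

lemma dot_minus_left: "dot d (- a) x = - dot d a x"
  by (simp add: dot_commute[of d _ x] linear_neg[OF linear_dot])

lemma dot_constraints:
  shows "j \<in> {1..m} \<Longrightarrow> dot_pair m k (- unit_vec j, 0) x = - coord (fst x) j"
    and "l \<in> {1..k} \<Longrightarrow> dot_pair m k (fvec_of m f, - unit_vec l) x =
      (\<Sum>j=1..m. f j * coord (fst x) j) - coord (snd x) l"
    and "l \<in> {1..k} \<Longrightarrow> dot_pair m k (- fvec_of m f, unit_vec l) x =
      coord (snd x) l - (\<Sum>j=1..m. f j * coord (fst x) j)"
  by (simp_all add: dot_pair_def dot_minus_left)

lemma sum_unit_vec:
  assumes "j \<in> {1..m}"
  shows "(\<Sum>i=1..m. f i * coord (unit_vec j) i) = f j"
  using assms by (simp add: if_distrib[of "\<lambda>c. _ * c"] sum.delta cong: if_cong)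

text \<open>
  For each coordinate l, the two general inequalities place y l between its smallest and its largest
  possible value; let t l be its relative position. Move, for every j at the same time, to the relative
  position t l in coordinate l of the box spanned by the two codes at j. These codes differ in at
  most one coordinate, so the box is a segment and the chosen point lies in the convex hull of the
  two vertices over j. As every coordinate has its own t l, the weighted sum over j is y.
\<close>

lemma gray_description_inner:
  assumes n: "n \<ge> 1" and H: "gray_encoding k n H"
    and x: "x \<in> Rn (n + 1)" "y \<in> Rn k"
    and sum: "(\<Sum>j=1..n + 1. coord x j) = 1" and nonneg: "\<And>j. j \<in> {1..n + 1} \<Longrightarrow> 0 \<le> coord x j"
    and lower: "\<And>l. l \<in> {1..k} \<Longrightarrow> (\<Sum>j=1..n + 1. lower_coeff n H l j * coord x j) \<le> coord y l"
    and upper: "\<And>l. l \<in> {1..k} \<Longrightarrow> coord y l \<le> (\<Sum>j=1..n + 1. upper_coeff n H l j * coord x j)"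
  shows "(x, y) \<in> embedding n (sos2 n) H"
proof -
  let ?lo = "lower_coeff n H" and ?up = "upper_coeff n H"
  have enc: "H \<in> encodings k n" using H by (simp add: gray_encoding_def)
  have "\<forall>l. \<exists>t\<in>{0..1}. l \<in> {1..k} \<longrightarrow>
    coord y l = (\<Sum>j=1..n + 1. ((1 - t) * ?lo l j + t * ?up l j) * coord x j)"
  proof
    fix l
    show "\<exists>t\<in>{0..1}. l \<in> {1..k} \<longrightarrow>
      coord y l = (\<Sum>j=1..n + 1. ((1 - t) * ?lo l j + t * ?up l j) * coord x j)"
    proof (cases "l \<in> {1..k}")
      case True
      let ?m = "\<Sum>j=1..n + 1. ?lo l j * coord x j" and ?M = "\<Sum>j=1..n + 1. ?up l j * coord x j"
      have "coord y l \<in> closed_segment ?m ?M"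
        using lower[OF True] upper[OF True] by (simp add: closed_segment_eq_real_ivl)
      then obtain t where t: "t \<in> {0..1}" "coord y l = (1 - t) * ?m + t * ?M"
        by (auto simp: closed_segment_def)
      have "(1 - t) * ?m + t * ?M = (\<Sum>j=1..n + 1. ((1 - t) * ?lo l j + t * ?up l j) * coord x j)"
        unfolding sum_distrib_left by (simp only: sum.distrib[symmetric] distrib_right mult.assoc)
      then show ?thesis using t by auto
    qed (auto intro: bexI[of _ 0])
  qed
  then obtain t where t: "\<And>l. t l \<in> {0..1}"
    and y: "\<And>l. l \<in> {1..k} \<Longrightarrow>
      coord y l = (\<Sum>j=1..n + 1. ((1 - t l) * ?lo l j + t l * ?up l j) * coord x j)"
    by metis
  define z where "z j = fvec_of k (\<lambda>l. (1 - t l) * ?lo l j + t l * ?up l j)" for j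
  have z: "(unit_vec j, z j) \<in> embedding n (sos2 n) H" if j: "j \<in> {1..n + 1}" for j
  proof -
    let ?a = "left_code H j" and ?b = "right_code n H j"
    obtain l where l: "\<And>l'. l' \<noteq> l \<Longrightarrow> coord ?a l' = coord ?b l'"
      using gray_left_right[OF n H j] by blast
    \<comment> \<open>t l measures from the smaller to the larger value, s from the left code to the right code.\<close>
    define s where "s = (if coord ?a l \<le> coord ?b l then t l else 1 - t l)"
    have s: "0 \<le> 1 - s" "0 \<le> s" using t[of l] by (auto simp: s_def)
    have V: "(unit_vec j, ?a) \<in> embedding_vertices n H" "(unit_vec j, ?b) \<in> embedding_vertices n H"
      using left_right_vertices[OF n j] by auto
    then have ab: "?a \<in> Rn k" "?b \<in> Rn k" using embedding_vertices_subset[OF enc] by auto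
    have "z j = (1 - s) *\<^sub>R ?a + s *\<^sub>R ?b"
    proof (rule Rn_eqI)
      show "z j \<in> Rn k" by (simp add: z_def)
      show "(1 - s) *\<^sub>R ?a + s *\<^sub>R ?b \<in> Rn k"
        using ab by (intro subspace_add subspace_scale subspace_Rn)
      fix l' assume l': "l' \<in> {1..k}"
      show "coord (z j) l' = coord ((1 - s) *\<^sub>R ?a + s *\<^sub>R ?b) l'"
      proof (cases "l' = l")
        case True
        then show ?thesis
          using l' by (simp add: z_def coord_fvec_of lookup_add s_def lower_coeff_def upper_coeff_def
              min_def max_def)
      next
        case False
        then show ?thesis
          using l' l[OF False]
          by (simp add: z_def coord_fvec_of lookup_add lower_coeff_def upper_coeff_def
              flip: distrib_right)
      qed
    qed
    then have "(unit_vec j, z j) = (1 - s) *\<^sub>R (unit_vec j, ?a) + s *\<^sub>R (unit_vec j, ?b)"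
      by (simp flip: scaleR_left_distrib)
    also have "\<dots> \<in> embedding n (sos2 n) H"
      unfolding embedding_sos2_eq using V s
      by (intro convexD[OF convex_convex_hull] hull_inc) auto
    finally show ?thesis .
  qed
  have "(\<Sum>j=1..n + 1. coord x j *\<^sub>R (unit_vec j, z j)) \<in> embedding n (sos2 n) H"
    using sum nonneg z by (intro convex_sum) (auto simp: embedding_def)
  moreover have "(\<Sum>j=1..n + 1. coord x j *\<^sub>R (unit_vec j, z j)) = (x, y)"
  proof (rule prod_eqI)
    have "fst (\<Sum>j=1..n + 1. coord x j *\<^sub>R (unit_vec j, z j)) = fvec_of (n + 1) (coord x)"
      by (simp only: fst_sum fst_scaleR fst_conv fvec_of_def)
    then show "fst (\<Sum>j=1..n + 1. coord x j *\<^sub>R (unit_vec j, z j)) = fst (x, y)"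
      using fvec_of_coord[OF x(1)] by simp
    have "(\<Sum>j=1..n + 1. coord x j *\<^sub>R z j) = y"
    proof (rule Rn_eqI[OF _ x(2)])
      show "(\<Sum>j=1..n + 1. coord x j *\<^sub>R z j) \<in> Rn k"
        by (intro subspace_sum subspace_scale subspace_Rn) (simp add: z_def)
      fix l assume l: "l \<in> {1..k}"
      then show "coord (\<Sum>j=1..n + 1. coord x j *\<^sub>R z j) l = coord y l"
        unfolding y[OF l] lookup_sum coord_scaleR z_def coord_fvec_of by (simp add: mult.commute)
    qed
    then show "snd (\<Sum>j=1..n + 1. coord x j *\<^sub>R (unit_vec j, z j)) = snd (x, y)"
      by (simp only: snd_sum snd_scaleR snd_conv)
  qed
  ultimately show ?thesis by simp
qed

text \<open>
  A description may contain an inequality only if some point satisfies it strictly. For the general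
  inequalities of coordinate l such a point is a vertex at a position where l changes.
\<close>

lemma gray_description:
  assumes n: "n \<ge> 1" and H: "gray_encoding k n H"
  shows "describes (n + 1) k {(sum_functional (n + 1), 1)}
    (bound_constraints n \<union> lower_constraints n k H \<union> upper_constraints n k H)
    (embedding n (sos2 n) H)"
proof -
  let ?W = "Rn (n + 1) \<times> Rn k" and ?d = "dot_pair (n + 1) k" and ?Q = "embedding n (sos2 n) H"
  let ?lo = "lower_coeff n H" and ?up = "upper_coeff n H"
  let ?E = "{(sum_functional (n + 1), 1 :: real)}"
  let ?I = "bound_constraints n \<union> lower_constraints n k H \<union> upper_constraints n k H"
  have enc: "H \<in> encodings k n" using H by (simp add: gray_encoding_def)
  have vertexI: "v \<in> ?Q" if "v \<in> embedding_vertices n H" for v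
    using that by (simp add: embedding_sos2_eq hull_inc)
  have I_iff: "(\<forall>(a, c)\<in>?I. ?d a x \<le> c) \<longleftrightarrow> (\<forall>j\<in>{1..n + 1}. 0 \<le> coord (fst x) j) \<and>
      (\<forall>l\<in>{1..k}. (\<Sum>j=1..n + 1. ?lo l j * coord (fst x) j) \<le> coord (snd x) l) \<and>
      (\<forall>l\<in>{1..k}. coord (snd x) l \<le> (\<Sum>j=1..n + 1. ?up l j * coord (fst x) j))" for x
    unfolding bound_constraints_def lower_constraints_def upper_constraints_def ball_Un
      ball_simps(9) case_prod_conv
    by (simp only: dot_constraints le_diff_eq diff_le_eq neg_le_0_iff_le add_0 cong: ball_cong)
      auto
  have vertex: "v \<in> ?W" "?d (sum_functional (n + 1)) v = 1" "\<forall>(a, c)\<in>?I. ?d a v \<le> c"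
    if v: "v \<in> embedding_vertices n H" for v
  proof -
    show "v \<in> ?W" using embedding_vertices_subset[OF enc] v by blast
    show "?d (sum_functional (n + 1)) v = 1" using v by (rule sum_functional_vertex)
    obtain j where j: "j \<in> {1..n + 1}" "fst v = unit_vec j"
      "snd v \<in> {left_code H j, right_code n H j}"
      using v by (rule embedding_vertex_cases)
    show "\<forall>(a, c)\<in>?I. ?d a v \<le> c"
      unfolding I_iff j(2) sum_unit_vec[OF j(1)]
      using j(3) by (auto simp: lower_coeff_def upper_coeff_def)
  qed
  have inW: "?Q \<subseteq> ?W"
    unfolding embedding_sos2_eq
    using vertex(1) subspace_imp_convex[OF subspace_Rn_Times] by (intro hull_minimal) auto
  have equation: "?d (sum_functional (n + 1)) x = 1" if "x \<in> ?Q" for x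
    using that unfolding embedding_eq_cone_section[OF enc] by blast
  have valid: "?d a x \<le> c" if ac: "(a, c) \<in> ?I" and "x \<in> ?Q" for a c x
  proof -
    have "?d a x \<in> {..c}"
    proof (rule embedding_functional_in_convex[OF linear_dot_pair _ _ \<open>x \<in> ?Q\<close>])
      show "?d a v \<in> {..c}" if "v \<in> embedding_vertices n H" for v
        using vertex(3)[OF that] ac by blast
    qed simp
    then show ?thesis by simp
  qed
  have inner: "x \<in> ?Q" if "x \<in> ?W" "?d (sum_functional (n + 1)) x = 1" "\<forall>(a, c)\<in>?I. ?d a x \<le> c"
    for x
    using gray_description_inner[OF n H, of "fst x" "snd x"] that
    unfolding I_iff dot_sum_functional by auto
  have Q: "?Q = {x \<in> ?W. (\<forall>(a, c)\<in>?E. ?d a x = c) \<and> (\<forall>(a, c)\<in>?I. ?d a x \<le> c)}"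
  proof (intro set_eqI iffI CollectI conjI)
    fix x assume x: "x \<in> ?Q"
    show "x \<in> ?W" using x inW by blast
    show "\<forall>(a, c)\<in>?E. ?d a x = c" using equation[OF x] by simp
    show "\<forall>(a, c)\<in>?I. ?d a x \<le> c" using valid[OF _ x] by blast
  next
    fix x assume "x \<in> {x \<in> ?W. (\<forall>(a, c)\<in>?E. ?d a x = c) \<and> (\<forall>(a, c)\<in>?I. ?d a x \<le> c)}"
    then show "x \<in> ?Q" by (intro inner) (elim CollectE conjE, simp)+
  qed
  have strict: "\<exists>x\<in>?Q. ?d a x < c" if "(a, c) \<in> ?I" for a c
  proof -
    have flip: "\<exists>j\<in>{1..n + 1}. coord (left_code H j) l \<noteq> coord (right_code n H j) l"
      if l: "l \<in> {1..k}" for l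
    proof -
      obtain i where i: "i \<in> {1..<n}" "coord (H (i + 1)) l \<noteq> coord (H i) l"
        using H l unfolding gray_encoding_def by blast
      then have "left_code H (i + 1) = H i" "right_code n H (i + 1) = H (i + 1)"
        by (auto simp: left_code_def right_code_def)
      then show ?thesis using i by (intro bexI[of _ "i + 1"]) auto
    qed
    consider (bound) j where "j \<in> {1..n + 1}" "a = (- unit_vec j, 0)" "c = 0"
      | (lower) l where "l \<in> {1..k}" "a = (fvec_of (n + 1) (?lo l), - unit_vec l)" "c = 0"
      | (upper) l where "l \<in> {1..k}" "a = (- fvec_of (n + 1) (?up l), unit_vec l)" "c = 0"
      using \<open>(a, c) \<in> ?I\<close>
      unfolding bound_constraints_def lower_constraints_def upper_constraints_def by blast
    then show ?thesis
    proof cases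
      case bound
      have "?d a (unit_vec j, left_code H j) < c"
        unfolding bound(2,3) dot_constraints(1)[OF bound(1)] by simp
      then show ?thesis using vertexI left_right_vertices(1)[OF n bound(1)] by blast
    next
      case lower
      obtain j where j: "j \<in> {1..n + 1}" "coord (left_code H j) l \<noteq> coord (right_code n H j) l"
        using flip[OF lower(1)] by blast
      have "?d a (unit_vec j, left_code H j) < c \<or> ?d a (unit_vec j, right_code n H j) < c"
        unfolding lower(2,3) dot_constraints(2)[OF lower(1)] fst_conv snd_conv sum_unit_vec[OF j(1)]
        using j(2) by (auto simp: lower_coeff_def)
      then show ?thesis using vertexI left_right_vertices[OF n j(1)] by blast
    next
      case upper
      obtain j where j: "j \<in> {1..n + 1}" "coord (left_code H j) l \<noteq> coord (right_code n H j) l"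
        using flip[OF upper(1)] by blast
      have "?d a (unit_vec j, left_code H j) < c \<or> ?d a (unit_vec j, right_code n H j) < c"
        unfolding upper(2,3) dot_constraints(3)[OF upper(1)] fst_conv snd_conv sum_unit_vec[OF j(1)]
        using j(2) by (auto simp: upper_coeff_def)
      then show ?thesis using vertexI left_right_vertices[OF n j(1)] by blast
    qed
  qed
  have "?E \<union> ?I \<subseteq> ?W \<times> UNIV"
    using sum_functional_in
    by (auto simp: bound_constraints_def lower_constraints_def upper_constraints_def
        subspace_0[OF subspace_Rn] subspace_neg[OF subspace_Rn])
  moreover have "finite ?E" "finite ?I"
    by (simp_all add: bound_constraints_def lower_constraints_def upper_constraints_def)
  ultimately show ?thesis
    unfolding describes_def using Q strict by blast
qed

lemma Inf_nat_attained:
  fixes K :: "nat set"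
  assumes "a \<in> K"
  shows "Inf K \<in> K \<and> Inf K \<le> a"
  using assms Inf_nat_def1[of K] cInf_lower[of a K] by auto

lemma poly_size_gray_le:
  assumes n: "n \<ge> 1" and H: "gray_encoding k n H"
  shows "poly_size (n + 1) k (embedding n (sos2 n) H) \<le> n + 3 + 2 * k"
proof -
  let ?E = "{(sum_functional (n + 1), 1 :: real)}"
  let ?I = "bound_constraints n \<union> lower_constraints n k H \<union> upper_constraints n k H"
  have "card (bound_constraints n) \<le> n + 1"
    unfolding bound_constraints_def by (rule order_trans[OF card_image_le]) simp_all
  moreover have "card (lower_constraints n k H) \<le> k"
    unfolding lower_constraints_def by (rule order_trans[OF card_image_le]) simp_all
  moreover have "card (upper_constraints n k H) \<le> k"
    unfolding upper_constraints_def by (rule order_trans[OF card_image_le]) simp_all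
  ultimately have "card ?I \<le> n + 1 + 2 * k"
    using card_Un_le[of "bound_constraints n \<union> lower_constraints n k H" "upper_constraints n k H"]
      card_Un_le[of "bound_constraints n" "lower_constraints n k H"] by linarith
  moreover have "poly_size (n + 1) k (embedding n (sos2 n) H) \<le> 2 * card ?E + card ?I"
    unfolding poly_size_def
  proof (rule cInf_lower)
    show "2 * card ?E + card ?I \<in>
      {2 * card E + card I | E I. describes (n + 1) k E I (embedding n (sos2 n) H)}"
      using gray_description[OF n H] by (intro CollectI exI conjI) (rule refl)
  qed simp
  ultimately show ?thesis by simp
qed

lemma poly_size_embedding_ge:
  assumes n: "n \<ge> 1" and H: "H \<in> encodings k n"
  shows "n + k + 3 \<le> poly_size (n + 1) k (embedding n (sos2 n) H)"
proof -
  let ?S = "{2 * card E + card I | E I. describes (n + 1) k E I (embedding n (sos2 n) H)}"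
  have "?S \<noteq> {}" using embedding_has_description[OF H] by blast
  then have "Inf ?S \<in> ?S" by (rule Inf_nat_def1)
  then show ?thesis
    unfolding poly_size_def using description_size_lower_bound[OF n H] by auto
qed

theorem proposition3:
  fixes n :: nat
  assumes "n \<ge> 1"
  shows "int (mc_G_sos2 n) = 2 * \<lceil>log 2 (real n)\<rceil> \<and>
    int n + 3 + \<lceil>log 2 (real n)\<rceil> \<le> int (mc (n + 1) n (sos2 n)) \<and>
    int (mc (n + 1) n (sos2 n)) \<le> int n + 3 + 2 * \<lceil>log 2 (real n)\<rceil>"
proof -
  \<comment> \<open>Gray codes of the smallest possible length give the upper bounds.\<close>
  define k where "k = nat \<lceil>log 2 (real n)\<rceil>"
  have "0 \<le> log 2 (real n)" using assms by simp
  then have k: "\<lceil>log 2 (real n)\<rceil> = int k" by (simp add: k_def)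
  have "log 2 (real n) \<le> real k" using k by linarith
  then have "real n \<le> 2 ^ k"
    using assms by (simp add: log_le_iff powr_realpow)
  then have nk: "n \<le> 2 ^ k" by (metis of_nat_le_iff of_nat_numeral of_nat_power)
  have k_min: "k = 0 \<or> 2 ^ (k - 1) < n"
  proof (rule ccontr)
    assume "\<not> ?thesis"
    then have "n \<le> 2 ^ (k - 1)" "k \<noteq> 0" by auto
    then show False using ceiling_log2_le[OF assms, of "k - 1"] k by simp
  qed
  obtain H where H: "gray_encoding k n H"
    using gray_encoding_exists[OF assms nk k_min] .
  have enc: "\<lceil>log 2 (real n)\<rceil> \<le> int k \<and> H \<in> encodings k n"
    using H k by (simp add: gray_encoding_def)
  let ?G = "{size_G_sos2 n k H | k H. \<lceil>log 2 (real n)\<rceil> \<le> int k \<and> H \<in> encodings k n}"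
  let ?S = "{poly_size (n + 1) k (embedding n (sos2 n) H) | k H.
    \<lceil>log 2 (real n)\<rceil> \<le> int k \<and> H \<in> encodings k n}"
  have "size_G_sos2 n k H \<in> ?G" using enc by blast
  from Inf_nat_attained[OF this]
  have G: "Inf ?G \<in> ?G" "Inf ?G \<le> size_G_sos2 n k H" by (rule conjunct1, rule conjunct2)
  have "2 * \<lceil>log 2 (real n)\<rceil> \<le> int (Inf ?G)"
    using G(1) ceiling_log2_le_card_spanned_hyperplanes[OF assms] unfolding size_G_sos2_def by force
  moreover have "size_G_sos2 n k H \<le> 2 * k"
    using card_spanned_hyperplanes_gray[OF assms H] by (simp add: size_G_sos2_def)
  ultimately have "int (mc_G_sos2 n) = 2 * \<lceil>log 2 (real n)\<rceil>"
    using G(2) k unfolding mc_G_sos2_def by linarith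
  moreover have "poly_size (n + 1) k (embedding n (sos2 n) H) \<in> ?S" using enc by blast
  from Inf_nat_attained[OF this]
  have S: "Inf ?S \<in> ?S" "Inf ?S \<le> poly_size (n + 1) k (embedding n (sos2 n) H)"
    by (rule conjunct1, rule conjunct2)
  have "int n + 3 + \<lceil>log 2 (real n)\<rceil> \<le> int (Inf ?S)"
  proof -
    obtain k' H' where "Inf ?S = poly_size (n + 1) k' (embedding n (sos2 n) H')"
      "\<lceil>log 2 (real n)\<rceil> \<le> int k'" "H' \<in> encodings k' n"
      using S(1) by blast
    then show ?thesis using poly_size_embedding_ge[OF assms, of H' k'] by linarith
  qed
  moreover have "int (Inf ?S) \<le> int n + 3 + 2 * \<lceil>log 2 (real n)\<rceil>"
    using S(2) poly_size_gray_le[OF assms H] k by linarith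
  ultimately show ?thesis unfolding mc_def by blast
qed

end
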